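(* Let $\Gamma$ be a random edge-labelled graph on $n$ vertices with label probabilities $p_m=p_m(n)$. If $np_3\to\infty$ as $n\to\infty$, then $W_\Gamma$ is asymptotically almost surely not hyperbolic.
   Context: Random edge-labelled graph: for each $n$, nonnegative numbers $p_m(n)$ ($m=2,3,4,\dots$) are given with $\sum_{m=2}^\infty p_m(n)\le 1$. On a vertex set of size $n$, independently for each pair of vertices, the pair is joined by an edge labelled $m$ with probability $p_m(n)$ for each integer $m\ge2$, and is not joined by an edge with the remaining probability. "Asymptotically almost surely" means with probability tending to $1$ as $n\to\infty$. Coxeter group: if $\Gamma$ has vertices $v_1,\dots,v_n$ and the edge between $v_i$ and $v_j$ (if present) has label $m_{i,j}$, then $W_\Gamma=\langle v_1,\dots,v_n\mid v_i^2,\ (v_iv_j)^{m_{i,j}}\rangle$, with the second type of relator only for adjacent pairs. A group is hyperbolic if its Cayley graph with respect to some (hence any) finite generating set is $\delta$-hyperbolic for some $\delta\ge0$, i.e. in every geodesic triangle the $\delta$-neighborhood of the union of two sides contains the third side. *)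

theory Defs
  imports "HOL-Probability.Probability" "HOL-Algebra.Generated_Groups"
begin

text \<open>A letter is a generator (\<open>True\<close>) or a formal inverse of one (\<open>False\<close>).\<close>

type_synonym 'a word = "('a \<times> bool) list"

definition words :: "'a set \<Rightarrow> 'a word set" where
  "words S = lists (S \<times> UNIV)"

text \<open>Equality of words in the group with generators \<open>S\<close> and relators \<open>R\<close>.\<close>

inductive pres_eq :: "'a set \<Rightarrow> 'a word set \<Rightarrow> 'a word \<Rightarrow> 'a word \<Rightarrow> bool"
  for S :: "'a set" and R :: "'a word set" where
  refl: "w \<in> words S \<Longrightarrow> pres_eq S R w w"
| sym: "pres_eq S R v w \<Longrightarrow> pres_eq S R w v"
| trans: "pres_eq S R u v \<Longrightarrow> pres_eq S R v w \<Longrightarrow> pres_eq S R u w"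
| cancel: "u \<in> words S \<Longrightarrow> v \<in> words S \<Longrightarrow> s \<in> S \<Longrightarrow>
    pres_eq S R (u @ [(s, b), (s, \<not> b)] @ v) (u @ v)"
| relator: "u \<in> words S \<Longrightarrow> v \<in> words S \<Longrightarrow> r \<in> R \<Longrightarrow> r \<in> words S \<Longrightarrow>
    pres_eq S R (u @ r @ v) (u @ v)"

definition pres_class :: "'a set \<Rightarrow> 'a word set \<Rightarrow> 'a word \<Rightarrow> 'a word set" where
  "pres_class S R w = {w'. pres_eq S R w w'}"

definition presented_group :: "'a set \<Rightarrow> 'a word set \<Rightarrow> 'a word set monoid" where
  "presented_group S R =
    \<lparr>carrier = pres_class S R ` words S,
     mult = (\<lambda>A B. \<Union>a\<in>A. \<Union>b\<in>B. pres_class S R (a @ b)),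
     one = pres_class S R []\<rparr>"

lemma pres_eq_words: "pres_eq S R v w \<Longrightarrow> v \<in> words S \<and> w \<in> words S"
  by (induction rule: pres_eq.induct) (auto simp: words_def)

lemma pres_eq_append_left:
  assumes "pres_eq S R v w" "u \<in> words S"
  shows "pres_eq S R (u @ v) (u @ w)"
  using assms
proof (induction rule: pres_eq.induct)
  case (refl w)
  then show ?case by (intro pres_eq.refl) (simp add: words_def)
next
  case (cancel u' v s b)
  then show ?case using pres_eq.cancel[of "u @ u'" S v s R b] by (simp add: words_def)
next
  case (relator u' v r)
  then show ?case using pres_eq.relator[of "u @ u'" S v r R] by (simp add: words_def)
next
  case sym
  then show ?case by (simp add: pres_eq.sym)
next
  case trans
  then show ?case by (meson pres_eq.trans)
qed

lemma pres_eq_append_right: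
  assumes "pres_eq S R v w" "u \<in> words S"
  shows "pres_eq S R (v @ u) (w @ u)"
  using assms
proof (induction rule: pres_eq.induct)
  case (refl w)
  then show ?case by (intro pres_eq.refl) (simp add: words_def)
next
  case (cancel u' v s b)
  then show ?case using pres_eq.cancel[of u' S "v @ u" s R b] by (simp add: words_def)
next
  case (relator u' v r)
  then show ?case using pres_eq.relator[of u' S "v @ u" r R] by (simp add: words_def)
next
  case sym
  then show ?case by (simp add: pres_eq.sym)
next
  case trans
  then show ?case by (meson pres_eq.trans)
qed

lemma pres_eq_append:
  "pres_eq S R v v' \<Longrightarrow> pres_eq S R w w' \<Longrightarrow> pres_eq S R (v @ w) (v' @ w')"
  by (rule pres_eq.trans[OF pres_eq_append_right pres_eq_append_left])
    (simp_all add: pres_eq_words)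

lemma pres_class_eqI: "pres_eq S R v w \<Longrightarrow> pres_class S R v = pres_class S R w"
  unfolding pres_class_def by (auto intro: pres_eq.trans pres_eq.sym)

lemma presented_group_mult:
  assumes "v \<in> words S" "w \<in> words S"
  shows "pres_class S R v \<otimes>\<^bsub>presented_group S R\<^esub> pres_class S R w = pres_class S R (v @ w)"
proof -
  have eq: "pres_class S R (a @ b) = pres_class S R (v @ w)"
    if "a \<in> pres_class S R v" "b \<in> pres_class S R w" for a b
  proof -
    have "pres_eq S R v a" "pres_eq S R w b"
      using that by (simp_all add: pres_class_def)
    then have "pres_eq S R (v @ w) (a @ b)"
      by (rule pres_eq_append)
    then show ?thesis
      by (rule pres_class_eqI[symmetric])
  qed
  have ne: "v \<in> pres_class S R v" "w \<in> pres_class S R w"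
    using assms by (simp_all add: pres_class_def pres_eq.refl)
  have "(\<Union>a\<in>pres_class S R v. \<Union>b\<in>pres_class S R w. pres_class S R (a @ b))
      = (\<Union>a\<in>pres_class S R v. \<Union>b\<in>pres_class S R w. pres_class S R (v @ w))"
    by (intro SUP_cong HOL.refl eq)
  also have "\<dots> = pres_class S R (v @ w)"
    using ne by blast
  finally show ?thesis
    by (simp add: presented_group_def)
qed

lemma pres_eq_inverse:
  "w \<in> words S \<Longrightarrow> pres_eq S R (rev (map (\<lambda>(s, b). (s, \<not> b)) w) @ w) []"
proof (induction w)
  case Nil
  then show ?case by (simp add: pres_eq.refl)
next
  case (Cons l w)
  obtain s b where l: "l = (s, b)" by force
  let ?u = "rev (map (\<lambda>(s, b). (s, \<not> b)) w)"
  have "?u \<in> words S" "w \<in> words S" "s \<in> S"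
    using Cons.prems l by (auto simp: words_def)
  then have "pres_eq S R (?u @ [(s, \<not> b), (s, \<not> \<not> b)] @ w) (?u @ w)"
    by (intro pres_eq.cancel)
  then show ?case
    using pres_eq.trans[OF _ Cons.IH[OF \<open>w \<in> words S\<close>]] l by simp
qed

lemma group_presented_group: "group (presented_group S R)"
proof (rule groupI)
  let ?G = "presented_group S R"
  have c: "carrier ?G = pres_class S R ` words S" and o: "\<one>\<^bsub>?G\<^esub> = pres_class S R []"
    by (simp_all add: presented_group_def)
  have nil: "[] \<in> words S" and app: "\<And>v w. v \<in> words S \<Longrightarrow> w \<in> words S \<Longrightarrow> v @ w \<in> words S"
    by (auto simp: words_def)
  show "x \<otimes>\<^bsub>?G\<^esub> y \<in> carrier ?G" if "x \<in> carrier ?G" "y \<in> carrier ?G" for x y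
    using that by (auto simp: c presented_group_mult app)
  show "\<one>\<^bsub>?G\<^esub> \<in> carrier ?G"
    using nil by (simp add: c o)
  show "x \<otimes>\<^bsub>?G\<^esub> y \<otimes>\<^bsub>?G\<^esub> z = x \<otimes>\<^bsub>?G\<^esub> (y \<otimes>\<^bsub>?G\<^esub> z)"
    if "x \<in> carrier ?G" "y \<in> carrier ?G" "z \<in> carrier ?G" for x y z
    using that by (auto simp: c presented_group_mult app)
  show "\<one>\<^bsub>?G\<^esub> \<otimes>\<^bsub>?G\<^esub> x = x" if "x \<in> carrier ?G" for x
    using that nil by (auto simp: c o presented_group_mult)
  show "\<exists>y\<in>carrier ?G. y \<otimes>\<^bsub>?G\<^esub> x = \<one>\<^bsub>?G\<^esub>" if x: "x \<in> carrier ?G" for x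
  proof -
    obtain w where w: "w \<in> words S" "x = pres_class S R w"
      using x c by auto
    let ?u = "rev (map (\<lambda>(s, b). (s, \<not> b)) w)"
    have u: "?u \<in> words S"
      using w(1) by (auto simp: words_def)
    have "pres_class S R ?u \<otimes>\<^bsub>?G\<^esub> x = \<one>\<^bsub>?G\<^esub>"
      using pres_class_eqI[OF pres_eq_inverse[OF w(1), of R]] u w
      by (simp add: presented_group_mult o)
    then show ?thesis
      using u c by blast
  qed
qed

text \<open>
  The vertex set is \<open>{..<n}\<close>. A labelled graph is a function on the unordered pairs
  \<open>{i, j}\<close> of vertices: \<open>Some m\<close> is an edge with label \<open>m\<close>, and \<open>None\<close> is no edge.
\<close>

type_synonym labelled_graph = "nat set \<Rightarrow> nat option"

definition vertex_pairs :: "nat \<Rightarrow> nat set set" where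
  "vertex_pairs n = {e. e \<subseteq> {..<n} \<and> card e = 2}"

definition label_pmf :: "(nat \<Rightarrow> real) \<Rightarrow> nat option pmf" where
  "label_pmf q = embed_pmf
    (\<lambda>l. case l of None \<Rightarrow> 1 - (\<Sum>\<^sub>\<infinity>m\<in>{2..}. q m) | Some m \<Rightarrow> if 2 \<le> m then q m else 0)"

lemma pmf_label_pmf:
  assumes "\<And>m. 2 \<le> m \<Longrightarrow> 0 \<le> q m" "q summable_on {2..}" "(\<Sum>\<^sub>\<infinity>m\<in>{2..}. q m) \<le> 1"
  shows "pmf (label_pmf q) None = 1 - (\<Sum>\<^sub>\<infinity>m\<in>{2..}. q m)"
    and "pmf (label_pmf q) (Some m) = (if 2 \<le> m then q m else 0)"
proof -
  let ?s = "\<Sum>\<^sub>\<infinity>m\<in>{2..}. q m"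
  let ?f = "\<lambda>l. case l of None \<Rightarrow> 1 - ?s | Some m \<Rightarrow> if 2 \<le> m then q m else 0"
  have nonneg: "0 \<le> ?f l" for l
    using assms by (auto split: option.split)
  have "(q has_sum ?s) {2..}"
    using assms(2) by (rule has_sum_infsum)
  then have "((\<lambda>m. if 2 \<le> m then q m else 0) has_sum ?s) UNIV"
    by (subst (asm) has_sum_cong_neutral[where T = UNIV and g = "\<lambda>m. if 2 \<le> m then q m else 0"]) auto
  then have "(?f has_sum ?s) (range Some)"
    by (subst has_sum_reindex) (auto simp: o_def)
  moreover have "(?f has_sum (1 - ?s)) {None}"
    using has_sum_finite[of "{None}" ?f] by simp
  ultimately have "(?f has_sum (1 - ?s + ?s)) ({None} \<union> range Some)"
    by (intro has_sum_Un_disjoint) auto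
  then have hs: "(?f has_sum 1) UNIV"
    by (simp add: UNIV_option_conv)
  then have "Infinite_Sum.abs_summable_on ?f UNIV"
    using nonneg by (simp add: has_sum_imp_summable)
  then have abs: "Infinite_Set_Sum.abs_summable_on ?f UNIV"
    by (simp only: abs_summable_equivalent)
  have "nn_integral (count_space UNIV) ?f = ennreal (infsetsum ?f UNIV)"
    using abs nonneg by (rule nn_integral_conv_infsetsum)
  also have "infsetsum ?f UNIV = 1"
    using infsetsum_infsum[OF abs] hs by (simp add: infsumI)
  finally have int: "nn_integral (count_space UNIV) ?f = 1"
    by simp
  have "pmf (label_pmf q) l = ?f l" for l
    unfolding label_pmf_def by (rule pmf_embed_pmf[OF nonneg int])
  then show "pmf (label_pmf q) None = 1 - ?s"
    and "pmf (label_pmf q) (Some m) = (if 2 \<le> m then q m else 0)"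
    by simp_all
qed

definition random_labelled_graph :: "(nat \<Rightarrow> real) \<Rightarrow> nat \<Rightarrow> labelled_graph pmf" where
  "random_labelled_graph q n = Pi_pmf (vertex_pairs n) None (\<lambda>_. label_pmf q)"

definition coxeter_group :: "nat \<Rightarrow> labelled_graph \<Rightarrow> nat word set monoid" where
  "coxeter_group n \<Gamma> = presented_group {..<n}
    ({[(i, True), (i, True)] |i. i < n} \<union>
     {concat (replicate m [(i, True), (j, True)]) |i j m.
        i < n \<and> j < n \<and> i \<noteq> j \<and> \<Gamma> {i, j} = Some m})"

text \<open>
  The geometric realization of a graph with vertex set \<open>V\<close> and symmetric irreflexive adjacency
  relation \<open>E\<close>: points are given by barycentric coordinates supported on a vertex or an edge.
\<close>

definition graph_realization :: "'a set \<Rightarrow> ('a \<times> 'a) set \<Rightarrow> ('a \<Rightarrow> real) set" where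
  "graph_realization V E =
    {x. (\<forall>w. 0 \<le> x w) \<and>
        (\<exists>u\<in>V. \<exists>v\<in>V. (u = v \<or> (u, v) \<in> E) \<and> (\<forall>w. w \<notin> {u, v} \<longrightarrow> x w = 0) \<and> sum x {u, v} = 1)}"

definition supp :: "('a \<Rightarrow> real) \<Rightarrow> 'a set" where
  "supp x = {v. x v \<noteq> 0}"

text \<open>Only meaningful when \<open>u\<close> and \<open>v\<close> are joined by a path.\<close>

definition edge_distance :: "('a \<times> 'a) set \<Rightarrow> 'a \<Rightarrow> 'a \<Rightarrow> nat" where
  "edge_distance E u v = (LEAST k. (u, v) \<in> E ^^ k)"

text \<open>
  The path metric of the realization with edges of length 1. Two points on a common edge are
  joined by a segment of that edge; otherwise a shortest path leaves the edge of \<open>x\<close> through an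
  end \<open>u\<close>, at distance \<open>1 - x u\<close> from \<open>x\<close>, and enters the edge of \<open>y\<close> through an end \<open>v\<close>.
\<close>

definition realization_dist :: "('a \<times> 'a) set \<Rightarrow> ('a \<Rightarrow> real) \<Rightarrow> ('a \<Rightarrow> real) \<Rightarrow> real" where
  "realization_dist E x y =
    (if \<exists>(u, v)\<in>E. supp x \<union> supp y \<subseteq> {u, v}
     then (\<Sum>w\<in>supp x \<union> supp y. \<bar>x w - y w\<bar>) / 2
     else Min ((\<lambda>(u, v). (1 - x u) + real (edge_distance E u v) + (1 - y v)) ` (supp x \<times> supp y)))"

definition geodesic_segment ::
    "'p set \<Rightarrow> ('p \<Rightarrow> 'p \<Rightarrow> real) \<Rightarrow> 'p \<Rightarrow> 'p \<Rightarrow> 'p set \<Rightarrow> bool" where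
  "geodesic_segment X d x y A \<longleftrightarrow>
    (\<exists>c L. 0 \<le> L \<and> c 0 = x \<and> c L = y \<and> c ` {0..L} \<subseteq> X \<and>
       (\<forall>s\<in>{0..L}. \<forall>t\<in>{0..L}. d (c s) (c t) = \<bar>s - t\<bar>) \<and> A = c ` {0..L})"

text \<open>
  Only the side \<open>C\<close> is tested, but the corners are arbitrary, so this covers every side.
\<close>

definition delta_hyperbolic :: "'p set \<Rightarrow> ('p \<Rightarrow> 'p \<Rightarrow> real) \<Rightarrow> real \<Rightarrow> bool" where
  "delta_hyperbolic X d \<delta> \<longleftrightarrow>
    (\<forall>x\<in>X. \<forall>y\<in>X. \<forall>z\<in>X. \<forall>A B C.
       geodesic_segment X d x y A \<and> geodesic_segment X d y z B \<and> geodesic_segment X d z x C \<longrightarrow>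
       (\<forall>c\<in>C. \<exists>b\<in>A \<union> B. d c b \<le> \<delta>))"

text \<open>
  The Cayley graph is taken as a simple graph: loops and multiple edges, which do not affect
  hyperbolicity, are dropped.
\<close>

definition cayley_edges :: "('a, 'b) monoid_scheme \<Rightarrow> 'a set \<Rightarrow> ('a \<times> 'a) set" where
  "cayley_edges G S =
    {(g, h). g \<in> carrier G \<and> h \<in> carrier G \<and> g \<noteq> h \<and>
       (\<exists>s\<in>S. h = g \<otimes>\<^bsub>G\<^esub> s \<or> g = h \<otimes>\<^bsub>G\<^esub> s)}"

definition hyperbolic_group :: "('a, 'b) monoid_scheme \<Rightarrow> bool" where
  "hyperbolic_group G \<longleftrightarrow>
    (\<exists>S. finite S \<and> S \<subseteq> carrier G \<and> generate G S = carrier G \<and>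
       (\<exists>\<delta>\<ge>0. delta_hyperbolic (graph_realization (carrier G) (cayley_edges G S))
                 (realization_dist (cayley_edges G S)) \<delta>))"

end

theory Submission
  imports Defs "HOL-Real_Asymp.Real_Asymp"
begin

text \<open>
  Asymptotically almost surely, the random graph contains a triangle all of whose edges are labelled 3.
  The number of such triangles has mean of order \<open>(n p\<^sub>3)\<^sup>3\<close>, and triangles without a common edge are
  independent, so its variance is small compared with the square of the mean, and Chebyshev's
  inequality applies (\<open>prob_no_triangle_le\<close>).

  On such a triangle the generators satisfy the relations of the affine Coxeter group that is generated
  by the reflections in the sides of an equilateral triangle in the plane. Products of four generators
  give two commuting translations (\<open>triangle_translations_commute\<close>). The relations
  of the other vertices could destroy the independence of these translations, but the reflection
  representation is defined for the whole Coxeter group and still shows them as independent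
  translations of a plane (\<open>act_pres_eq\<close>, \<open>act_translation_pow\<close>). So the group contains a free abelian group
  of rank 2.

  A hyperbolic group contains no such subgroup
  (\<open>not_hyperbolic_if_free_abelian_rank_2\<close>). If \<open>g\<close> commutes with a very long element \<open>h\<close>, then a
  geodesic from \<open>1\<close> to \<open>h\<close> and its translate by \<open>g\<close> are two sides of a quadrilateral with two short
  sides. Thinness puts a middle point \<open>x\<close> of the geodesic within bounded distance of a point \<open>g y\<close> of
  the translate, and \<open>g\<close> is determined by \<open>y\<close> and the short
  difference between \<open>x\<close> and \<open>g y\<close>. As \<open>y\<close> ranges over a segment whose length is linear in
  the length of \<open>g\<close>, the number of elements of length at most \<open>R\<close> that commute with \<open>h\<close> grows at most
  linearly in \<open>R\<close>, whereas the growth in a free abelian group of rank 2 is at least quadratic.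

  Hyperbolicity is a condition on the geometric realization of the Cayley graph, whereas the argument
  counts vertices. The transfer rests on the fact that a geodesic vertex path traces a geodesic
  of the realization (\<open>realization_dist_path_point\<close>, \<open>thin_triangle_of_paths\<close>).
\<close>

section \<open>Geodesics in a graph\<close>

lemma edge_distance_le: "(u, v) \<in> E ^^ k \<Longrightarrow> edge_distance E u v \<le> k"
  unfolding edge_distance_def by (rule Least_le)

lemma edge_distance_relpow: "(u, v) \<in> E\<^sup>* \<Longrightarrow> (u, v) \<in> E ^^ edge_distance E u v"
  unfolding edge_distance_def using rtrancl_imp_relpow by (metis LeastI)

lemma edge_distance_triangle:
  assumes "(u, v) \<in> E\<^sup>*" "(v, w) \<in> E\<^sup>*"
  shows "edge_distance E u w \<le> edge_distance E u v + edge_distance E v w"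
  using assms by (blast intro: edge_distance_le relpow_trans edge_distance_relpow)

lemma edge_distance_self [simp]: "edge_distance E u u = 0"
  using edge_distance_le[of u u 0 E] by simp

lemma edge_distance_edge: "(u, v) \<in> E \<Longrightarrow> edge_distance E u v \<le> 1"
  by (rule edge_distance_le) simp

lemma relpow_symD: "Relation.sym E \<Longrightarrow> (u, v) \<in> E ^^ k \<Longrightarrow> (v, u) \<in> E ^^ k"
proof (induction k arbitrary: u v)
  case (Suc k)
  then obtain w where "(u, w) \<in> E ^^ k" "(w, v) \<in> E" by auto
  with Suc have "(w, u) \<in> E ^^ k" "(v, w) \<in> E" by (auto dest: symD)
  then show ?case by (blast intro: relpow_Suc_I2)
qed simp

lemma edge_distance_commute: "Relation.sym E \<Longrightarrow> edge_distance E u v = edge_distance E v u"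
  unfolding edge_distance_def by (intro arg_cong[where f = Least] ext) (blast intro: relpow_symD)

definition geodesic_path :: "('a \<times> 'a) set \<Rightarrow> (nat \<Rightarrow> 'a) \<Rightarrow> nat \<Rightarrow> bool" where
  "geodesic_path E v L \<longleftrightarrow> (\<forall>i<L. (v i, v (Suc i)) \<in> E) \<and> edge_distance E (v 0) (v L) = L"

lemma geodesic_path_exists:
  assumes "(u, w) \<in> E\<^sup>*"
  obtains v where "geodesic_path E v (edge_distance E u w)" "v 0 = u" "v (edge_distance E u w) = w"
  using edge_distance_relpow[OF assms] unfolding relpow_fun_conv geodesic_path_def by auto

lemma path_relpow:
  assumes "\<And>i. i < L \<Longrightarrow> (v i, v (Suc i)) \<in> E" "i \<le> j" "j \<le> L"
  shows "(v i, v j) \<in> E ^^ (j - i)"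
  unfolding relpow_fun_conv using assms by (intro exI[of _ "\<lambda>k. v (i + k)"]) auto

lemma geodesic_path_distance:
  assumes g: "geodesic_path E v L" and "i \<le> j" "j \<le> L"
  shows "edge_distance E (v i) (v j) = j - i"
proof (rule antisym)
  have path: "(v k, v l) \<in> E ^^ (l - k)" if "k \<le> l" "l \<le> L" for k l
    using g that by (intro path_relpow) (auto simp: geodesic_path_def)
  then show "edge_distance E (v i) (v j) \<le> j - i"
    using assms by (intro edge_distance_le)
  have "(v 0, v i) \<in> E ^^ i" "(v j, v L) \<in> E ^^ (L - j)"
    using path[of 0 i] path[of j L] assms by auto
  moreover have "(v i, v j) \<in> E ^^ edge_distance E (v i) (v j)"
    using path[of i j] assms by (intro edge_distance_relpow) (auto intro: relpow_imp_rtrancl)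
  ultimately have "(v 0, v L) \<in> E ^^ (i + edge_distance E (v i) (v j) + (L - j))"
    by (blast intro: relpow_trans)
  then have "L \<le> i + edge_distance E (v i) (v j) + (L - j)"
    using g edge_distance_le unfolding geodesic_path_def by fastforce
  then show "j - i \<le> edge_distance E (v i) (v j)"
    using assms by linarith
qed

lemma geodesic_path_inj: "geodesic_path E v L \<Longrightarrow> inj_on v {..L}"
proof (rule linorder_inj_onI)
  fix i j assume "geodesic_path E v L" "i < j" "i \<in> {..L}" "j \<in> {..L}"
  then show "v i \<noteq> v j"
    using geodesic_path_distance[of E v L i j] by auto
qed auto

section \<open>Geodesics in the geometric realization\<close>

text \<open>
  The point at arc length \<open>s\<close> along a vertex path has as barycentric coordinate at \<open>v k\<close> the tent
  function with peak \<open>k\<close>. This uniform description avoids choosing an edge that contains the point.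
\<close>

definition path_point :: "(nat \<Rightarrow> 'a) \<Rightarrow> nat \<Rightarrow> real \<Rightarrow> 'a \<Rightarrow> real" where
  "path_point v L s = (\<lambda>w. \<Sum>k\<le>L. if v k = w then max 0 (1 - \<bar>s - real k\<bar>) else 0)"

lemma path_point_vertex:
  assumes "inj_on v {..L}" "k \<le> L"
  shows "path_point v L s (v k) = max 0 (1 - \<bar>s - real k\<bar>)"
proof -
  have "path_point v L s (v k) = (\<Sum>i\<in>{k}. max 0 (1 - \<bar>s - real i\<bar>))"
    unfolding path_point_def using assms
    by (intro sum.mono_neutral_cong_right) (auto dest: inj_onD)
  then show ?thesis by simp
qed

lemma path_point_outside: "w \<notin> v ` {..L} \<Longrightarrow> path_point v L s w = 0"
  unfolding path_point_def by (intro sum.neutral) auto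

lemma path_point_nonneg: "0 \<le> path_point v L s w"
  unfolding path_point_def by (intro sum_nonneg) auto

lemma supp_path_point:
  assumes "inj_on v {..L}"
  shows "supp (path_point v L s) = v ` {k. k \<le> L \<and> \<bar>s - real k\<bar> < 1}"
proof -
  have "w \<in> supp (path_point v L s) \<longleftrightarrow> w \<in> v ` {k. k \<le> L \<and> \<bar>s - real k\<bar> < 1}" for w
  proof (cases "w \<in> v ` {..L}")
    case True
    then obtain k where "w = v k" "k \<le> L" by auto
    moreover from this have "v k \<in> v ` {k. k \<le> L \<and> \<bar>s - real k\<bar> < 1} \<longleftrightarrow> \<bar>s - real k\<bar> < 1"
      using inj_on_image_mem_iff[OF assms, of k "{k. k \<le> L \<and> \<bar>s - real k\<bar> < 1}"] by auto
    ultimately show ?thesis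
      using assms by (auto simp: supp_def path_point_vertex max_def)
  next
    case False
    then show ?thesis by (auto simp: supp_def path_point_outside)
  qed
  then show ?thesis by blast
qed

lemma arc_length_cases:
  fixes s :: real
  assumes "0 \<le> s" "s \<le> real L"
  obtains i where "i \<le> L" "s = real i" | i where "Suc i \<le> L" "real i < s" "s < real (Suc i)"
proof -
  define i where "i = nat \<lfloor>s\<rfloor>"
  have i: "real i \<le> s" "s < real i + 1" using assms by (auto simp: i_def)
  show ?thesis
  proof (cases "s = real i")
    case True
    then show ?thesis using that(1)[of i] assms by auto
  next
    case False
    then have "real i < s" "real i < real L" using i assms by auto
    then show ?thesis using that(2)[of i] i by auto
  qed
qed

lemma path_point_realization:
  assumes inj: "inj_on v {..L}" and E: "\<And>i. i < L \<Longrightarrow> (v i, v (Suc i)) \<in> E"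
    and V: "\<And>i. i \<le> L \<Longrightarrow> v i \<in> V" and s: "0 \<le> s" "s \<le> real L"
  shows "path_point v L s \<in> graph_realization V E"
proof -
  have zero: "path_point v L s w = 0" if "w \<notin> v ` {k. k \<le> L \<and> \<bar>s - real k\<bar> < 1}" for w
    using that supp_path_point[OF inj, of s] by (auto simp: supp_def)
  obtain u w where "u \<in> V" "w \<in> V" "u = w \<or> (u, w) \<in> E"
    "v ` {k. k \<le> L \<and> \<bar>s - real k\<bar> < 1} \<subseteq> {u, w}" "sum (path_point v L s) {u, w} = 1"
  proof (cases rule: arc_length_cases[OF s])
    case (1 i)
    have "k = i" if "\<bar>real i - real k\<bar> < 1" for k using that by linarith
    then have "{k. k \<le> L \<and> \<bar>s - real k\<bar> < 1} \<subseteq> {i}" using 1 by blast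
    moreover have "path_point v L s (v i) = 1" using 1 by (simp add: path_point_vertex[OF inj])
    ultimately show ?thesis
      using 1 V by (intro that[of "v i" "v i"]) auto
  next
    case (2 i)
    have "k = i \<or> k = Suc i" if "\<bar>s - real k\<bar> < 1" for k using that 2 by linarith
    then have "{k. k \<le> L \<and> \<bar>s - real k\<bar> < 1} \<subseteq> {i, Suc i}" by blast
    moreover have "v i \<noteq> v (Suc i)" using inj 2 by (auto dest!: inj_onD)
    moreover have "path_point v L s (v i) = 1 - (s - real i)"
      "path_point v L s (v (Suc i)) = s - real i"
      using 2 by (simp_all add: path_point_vertex[OF inj])
    ultimately show ?thesis
      using 2 V E by (intro that[of "v i" "v (Suc i)"]) auto
  qed
  moreover from this have "\<forall>w'. w' \<notin> {u, w} \<longrightarrow> path_point v L s w' = 0"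
    by (intro allI impI zero) (rule contra_subsetD)
  ultimately have "\<exists>u\<in>V. \<exists>w\<in>V. (u = w \<or> (u, w) \<in> E) \<and>
      (\<forall>w'. w' \<notin> {u, w} \<longrightarrow> path_point v L s w' = 0) \<and> sum (path_point v L s) {u, w} = 1"
    by (intro bexI[of _ u, OF bexI[of _ w]] conjI)
  then show ?thesis
    by (simp add: graph_realization_def path_point_nonneg)
qed

text \<open>
  Let \<open>s \<le> t\<close>. If the two points lie on a common edge, half the \<open>l1\<close>-distance of the
  barycentric coordinates is \<open>t - s\<close>. Otherwise a vertex of the path separates them, so the candidate
  through the vertices \<open>\<lceil>s\<rceil>\<close> and \<open>\<lfloor>t\<rfloor>\<close> has length \<open>t - s\<close>, and no other candidate is shorter,
  by the triangle inequality in \<open>\<real>\<close>.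
\<close>

lemma realization_dist_path_point:
  assumes g: "geodesic_path E v L" and s: "0 \<le> s" "s \<le> real L" and t: "0 \<le> t" "t \<le> real L"
    and sym: "Relation.sym E"
  shows "realization_dist E (path_point v L s) (path_point v L t) = \<bar>s - t\<bar>"
proof -
  let ?x = "path_point v L"
  let ?K = "\<lambda>s. {k. k \<le> L \<and> \<bar>s - real k\<bar> < 1}"
  note inj = geodesic_path_inj[OF g]
  note supp = supp_path_point[OF inj]
  have val: "?x s (v k) = 1 - \<bar>s - real k\<bar>" if "k \<in> ?K s" for k s
    using that by (simp add: path_point_vertex[OF inj])
  have dist: "real (edge_distance E (v k) (v l)) = \<bar>real k - real l\<bar>" if "k \<le> L" "l \<le> L" for k l
    using geodesic_path_distance[OF g, of k l] geodesic_path_distance[OF g, of l k] that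
      edge_distance_commute[OF sym, of "v k" "v l"]
    by (cases "k \<le> l") (auto simp: of_nat_diff)
  have E: "(v i, v (Suc i)) \<in> E" if "Suc i \<le> L" for i
    using g that by (auto simp: geodesic_path_def)
  show ?thesis
  proof (cases "\<exists>(u, w)\<in>E. supp (?x s) \<union> supp (?x t) \<subseteq> {u, w}")
    case True
    have near: "\<bar>real k - real l\<bar> \<le> 1" if "k \<in> ?K s \<union> ?K t" "l \<in> ?K s \<union> ?K t" for k l
    proof -
      obtain u w where uw: "(u, w) \<in> E" "supp (?x s) \<union> supp (?x t) \<subseteq> {u, w}"
        using True by auto
      then have "v k \<in> {u, w}" "v l \<in> {u, w}" using that unfolding supp by blast+
      then have "edge_distance E (v k) (v l) \<le> 1"
        using uw(1) edge_distance_edge[of _ _ E] edge_distance_commute[OF sym]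
        by (metis edge_distance_self insertE le0 singletonD)
      then show ?thesis using dist[of k l] that by auto
    qed
    have "(\<Sum>w\<in>supp (?x s) \<union> supp (?x t). \<bar>?x s w - ?x t w\<bar>) = 2 * \<bar>s - t\<bar>"
    proof (cases "s = t")
      case False
      \<comment> \<open>Distinct points on a common edge lie in one interval \<open>[i, i + 1]\<close>.\<close>
      obtain i where i: "Suc i \<le> L" "real i \<le> s" "s \<le> real (Suc i)" "real i \<le> t" "t \<le> real (Suc i)"
      proof -
        have aux: "\<exists>i. Suc i \<le> L \<and> real i \<le> a \<and> a \<le> real (Suc i) \<and> real i \<le> b \<and> b \<le> real (Suc i)"
          if ab: "a < b" "0 \<le> a" "b \<le> real L" "{a, b} = {s, t}" for a b
        proof -
          define i where "i = nat \<lfloor>a\<rfloor>"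
          have i: "real i \<le> a" "a < real i + 1" using ab by (auto simp: i_def)
          define j where "j = nat \<lceil>b\<rceil>"
          have j: "b \<le> real j" "real j < b + 1" using ab by (auto simp: j_def) linarith+
          have "j \<le> L" using ab j by linarith
          moreover have "i < j" using i j ab by linarith
          ultimately have "\<bar>real i - real j\<bar> \<le> 1"
            using ab(4) i j by (intro near) (auto simp: doubleton_eq_iff)
          then have "j = Suc i" using \<open>i < j\<close> by linarith
          then show ?thesis using i j \<open>j \<le> L\<close> by auto
        qed
        consider "s < t" | "t < s" using False by linarith
        then show ?thesis
          using aux[of s t] aux[of t s] s t that by cases (auto simp: insert_commute)
      qed
      have ne: "v i \<noteq> v (Suc i)" using inj i by (auto dest!: inj_onD)
      have K: "?K s \<union> ?K t = {i, Suc i}"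
      proof (intro equalityI subsetI)
        fix k assume k: "k \<in> ?K s \<union> ?K t"
        then have "i \<le> k" "k \<le> Suc i" using i by auto
        then show "k \<in> {i, Suc i}" by auto
      next
        fix k assume "k \<in> {i, Suc i}"
        moreover have "\<bar>s - real i\<bar> < 1 \<or> \<bar>t - real i\<bar> < 1"
          "\<bar>s - real (Suc i)\<bar> < 1 \<or> \<bar>t - real (Suc i)\<bar> < 1"
          using i False by auto
        ultimately show "k \<in> ?K s \<union> ?K t" using i(1) by auto
      qed
      then have "supp (?x s) \<union> supp (?x t) = {v i, v (Suc i)}"
        unfolding supp image_Un[symmetric] by auto
      moreover have "?x r (v i) = 1 - (r - real i)" "?x r (v (Suc i)) = r - real i"
        if "real i \<le> r" "r \<le> real (Suc i)" for r
        using that i by (auto simp: path_point_vertex[OF inj])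
      ultimately show ?thesis using i ne by simp
    qed simp
    with True show ?thesis by (simp add: realization_dist_def)
  next
    case False
    let ?f = "\<lambda>(u, w). (1 - ?x s u) + real (edge_distance E u w) + (1 - ?x t w)"
    have f: "?f (v k, v l) = \<bar>s - real k\<bar> + \<bar>real k - real l\<bar> + \<bar>t - real l\<bar>"
      if "k \<in> ?K s" "l \<in> ?K t" for k l
      using val that dist[of k l] by simp
    have "\<exists>k\<in>?K s. \<exists>l\<in>?K t. \<bar>s - real k\<bar> + \<bar>real k - real l\<bar> + \<bar>t - real l\<bar> = \<bar>s - t\<bar>"
    proof -
      have aux: "\<exists>k l. k \<in> ?K a \<and> l \<in> ?K b \<and> a \<le> real k \<and> k \<le> l \<and> real l \<le> b"
        if ab: "a \<le> b" "0 \<le> a" "b \<le> real L" "{a, b} = {s, t}" for a b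
      proof -
        define k where "k = nat \<lceil>a\<rceil>"
        define l where "l = nat \<lfloor>b\<rfloor>"
        have k: "a \<le> real k" "real k < a + 1" using ab by (auto simp: k_def) linarith+
        have l: "real l \<le> b" "b < real l + 1" using ab by (auto simp: l_def)
        have "k \<le> l"
        proof (rule ccontr)
          \<comment> \<open>Otherwise both points are interior to the edge from \<open>v l\<close> to \<open>v (Suc l)\<close>.\<close>
          assume "\<not> k \<le> l"
          then have k_Suc: "k = Suc l" using k l ab by linarith
          have "m \<in> {l, Suc l}" if "m \<in> ?K a \<union> ?K b" for m
          proof -
            have "real l - 1 < real m" "real m < real l + 2"
              using that k l ab(1) k_Suc by auto
            then have "l \<le> m" "m \<le> Suc l" by linarith+
            then show ?thesis by auto
          qed
          moreover have "?K s \<union> ?K t = ?K a \<union> ?K b"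
          proof -
            consider "a = s" "b = t" | "a = t" "b = s" using ab(4) by (auto simp: doubleton_eq_iff)
            then show ?thesis by cases (simp_all add: Un_commute)
          qed
          ultimately have "?K s \<union> ?K t \<subseteq> {l, Suc l}"
            by (intro subsetI) simp
          then have "v ` (?K s \<union> ?K t) \<subseteq> v ` {l, Suc l}"
            by (rule image_mono)
          then have "supp (?x s) \<union> supp (?x t) \<subseteq> {v l, v (Suc l)}"
            unfolding supp image_Un by simp
          moreover have "Suc l \<le> L" using k k_Suc ab l by linarith
          ultimately have "\<exists>(u, w)\<in>E. supp (?x s) \<union> supp (?x t) \<subseteq> {u, w}"
            by (intro bexI[OF _ E]) simp
          with False show False by (rule notE)
        qed
        then show ?thesis using k l ab by (intro exI[of _ k] exI[of _ l]) auto
      qed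
      show ?thesis
      proof (cases "s \<le> t")
        case True
        then obtain k l where "k \<in> ?K s" "l \<in> ?K t" "s \<le> real k" "k \<le> l" "real l \<le> t"
          using aux[OF True s(1) t(2) HOL.refl] by (elim exE conjE)
        then show ?thesis using True by (intro bexI[of _ k] bexI[of _ l]) auto
      next
        case False
        then have "t \<le> s" by simp
        from aux[OF this t(1) s(2) insert_commute]
        obtain k l where "k \<in> ?K t" "l \<in> ?K s" "t \<le> real k" "k \<le> l" "real l \<le> s"
          by (elim exE conjE)
        then show ?thesis using False by (intro bexI[of _ l] bexI[of _ k]) auto
      qed
    qed
    then obtain k where kl1: "k \<in> ?K s"
      and "\<exists>l\<in>?K t. \<bar>s - real k\<bar> + \<bar>real k - real l\<bar> + \<bar>t - real l\<bar> = \<bar>s - t\<bar>"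
      by (rule bexE)
    then obtain l where kl2: "l \<in> ?K t"
      and kl3: "\<bar>s - real k\<bar> + \<bar>real k - real l\<bar> + \<bar>t - real l\<bar> = \<bar>s - t\<bar>"
      by blast
    have att: "(v k, v l) \<in> supp (?x s) \<times> supp (?x t)"
      unfolding supp using kl1 kl2 by blast
    have ge: "\<bar>s - t\<bar> \<le> ?f p" if "p \<in> supp (?x s) \<times> supp (?x t)" for p
    proof -
      have p: "fst p \<in> v ` ?K s" "snd p \<in> v ` ?K t"
        using that unfolding supp mem_Times_iff by simp_all
      obtain k where k: "fst p = v k" "k \<in> ?K s" using p(1) by (rule imageE)
      obtain l where l: "snd p = v l" "l \<in> ?K t" using p(2) by (rule imageE)
      have "p = (v k, v l)" using k l by (simp add: prod_eq_iff)
      then have eq: "?f p = \<bar>s - real k\<bar> + \<bar>real k - real l\<bar> + \<bar>t - real l\<bar>"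
        by (rule forw_subst) (rule f[OF k(2) l(2)])
      show ?thesis unfolding eq by linarith
    qed
    have "Min (?f ` (supp (?x s) \<times> supp (?x t))) = \<bar>s - t\<bar>"
    proof (rule Min_eqI)
      show "finite (?f ` (supp (?x s) \<times> supp (?x t)))" unfolding supp by simp
      show "\<bar>s - t\<bar> \<in> ?f ` (supp (?x s) \<times> supp (?x t))"
        by (rule image_eqI[OF _ att])
          (unfold prod.case f[OF kl1 kl2, unfolded prod.case], rule kl3[symmetric])
      fix y assume "y \<in> ?f ` (supp (?x s) \<times> supp (?x t))"
      then obtain p where p: "y = ?f p" "p \<in> supp (?x s) \<times> supp (?x t)"
        by (rule imageE)
      show "\<bar>s - t\<bar> \<le> y" unfolding p(1) using p(2) by (rule ge)
    qed
    with False show ?thesis by (simp add: realization_dist_def)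
  qed
qed

definition vertex_point :: "'a \<Rightarrow> 'a \<Rightarrow> real" where
  "vertex_point u = (\<lambda>w. if w = u then 1 else 0)"

lemma path_point_real:
  assumes inj: "inj_on v {..L}" and "i \<le> L"
  shows "path_point v L (real i) = vertex_point (v i)"
proof
  fix w
  show "path_point v L (real i) w = vertex_point (v i) w"
  proof (cases "w \<in> v ` {..L}")
    case True
    then obtain k where k: "w = v k" "k \<le> L" by auto
    moreover have "v k = v i \<longleftrightarrow> k = i"
      using inj k assms(2) by (auto dest: inj_onD)
    moreover have "1 \<le> \<bar>real i - real k\<bar>" if "k \<noteq> i" using that by linarith
    ultimately show ?thesis
      using path_point_vertex[OF inj k(2), of "real i"] by (auto simp: vertex_point_def)
  next
    case False
    then have "w \<noteq> v i" using assms(2) by auto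
    then show ?thesis using False by (simp add: path_point_outside vertex_point_def)
  qed
qed

lemma geodesic_segment_path:
  assumes g: "geodesic_path E v L" and sym: "Relation.sym E" and V: "\<And>i. i \<le> L \<Longrightarrow> v i \<in> V"
  shows "geodesic_segment (graph_realization V E) (realization_dist E)
    (vertex_point (v 0)) (vertex_point (v L)) (path_point v L ` {0..real L})"
  unfolding geodesic_segment_def
proof (intro exI conjI)
  note inj = geodesic_path_inj[OF g]
  show "path_point v L 0 = vertex_point (v 0)" "path_point v L (real L) = vertex_point (v L)"
    using path_point_real[OF inj, of 0] path_point_real[OF inj, of L] by auto
  have "path_point v L s \<in> graph_realization V E" if "0 \<le> s" "s \<le> real L" for s
    by (rule path_point_realization[OF inj _ V that]) (use g in \<open>auto simp: geodesic_path_def\<close>)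
  then show "path_point v L ` {0..real L} \<subseteq> graph_realization V E" by auto
  show "\<forall>s\<in>{0..real L}. \<forall>t\<in>{0..real L}.
      realization_dist E (path_point v L s) (path_point v L t) = \<bar>s - t\<bar>"
    using realization_dist_path_point[OF g _ _ _ _ sym] by auto
qed auto

text \<open>Passing from a point to an end of its edge costs at most the length of the edge.\<close>

lemma near_vertex:
  assumes x: "x \<in> graph_realization V E" and sym: "Relation.sym E"
    and d: "realization_dist E (vertex_point u) x \<le> \<delta>" and "0 \<le> \<delta>"
  obtains w where "w \<in> supp x" "real (edge_distance E u w) \<le> \<delta> + 1"
proof -
  obtain a b where ab: "\<And>w. 0 \<le> x w" "\<And>w. w \<notin> {a, b} \<Longrightarrow> x w = 0" "sum x {a, b} = 1"
    using x unfolding graph_realization_def by auto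
  have sub: "supp x \<subseteq> {a, b}" using ab(2) by (auto simp: supp_def)
  then have fin: "finite (supp x)" by (rule finite_subset) simp
  have ne: "supp x \<noteq> {}"
  proof
    assume "supp x = {}"
    then have "x = (\<lambda>_. 0)" by (auto simp: supp_def)
    with ab(3) show False by simp
  qed
  have le1: "x w \<le> 1" if "w \<in> supp x" for w
    using member_le_sum[of w "{a, b}" x] ab that sub by auto
  have supp_u: "supp (vertex_point u) = {u}" by (auto simp: supp_def vertex_point_def)
  show thesis
  proof (cases "\<exists>(p, q)\<in>E. supp (vertex_point u) \<union> supp x \<subseteq> {p, q}")
    case True
    then obtain p q where pq: "(p, q) \<in> E" "u \<in> {p, q}" "supp x \<subseteq> {p, q}"
      unfolding supp_u by auto
    obtain w where w: "w \<in> supp x" using ne by auto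
    then have "u = w \<or> (u, w) \<in> E"
      using pq symD[OF sym pq(1)] by auto
    then have "edge_distance E u w \<le> 1"
      using edge_distance_edge by fastforce
    then show ?thesis using that[OF w] \<open>0 \<le> \<delta>\<close> by linarith
  next
    case False
    let ?f = "\<lambda>(p, w). (1 - vertex_point u p) + real (edge_distance E p w) + (1 - x w)"
    have "realization_dist E (vertex_point u) x = Min (?f ` ({u} \<times> supp x))"
      using False unfolding realization_dist_def supp_u by simp
    also have "\<dots> \<in> ?f ` ({u} \<times> supp x)"
      using fin ne by (intro Min_in) auto
    finally obtain w where "w \<in> supp x"
      "realization_dist E (vertex_point u) x = real (edge_distance E u w) + (1 - x w)"
      by (auto simp: vertex_point_def)
    then show ?thesis using that[of w] d le1[of w] by linarith
  qed
qed

text \<open>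
  The constant \<open>\<delta> + 1\<close> instead of \<open>\<delta>\<close> pays for moving from a nearby point of the realization to a
  vertex. The corners are ordered cyclically, as in the definition of a thin triangle.
\<close>

lemma thin_triangle_of_paths:
  assumes hyp: "delta_hyperbolic (graph_realization V E) (realization_dist E) \<delta>" "0 \<le> \<delta>"
    and sym: "Relation.sym E"
    and a: "geodesic_path E \<alpha> a" "\<And>i. i \<le> a \<Longrightarrow> \<alpha> i \<in> V"
    and b: "geodesic_path E \<beta> b" "\<And>i. i \<le> b \<Longrightarrow> \<beta> i \<in> V"
    and c: "geodesic_path E \<gamma> c" "\<And>i. i \<le> c \<Longrightarrow> \<gamma> i \<in> V"
    and corners: "\<alpha> a = \<beta> 0" "\<beta> b = \<gamma> 0" "\<gamma> c = \<alpha> 0" and i: "i \<le> c"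
  shows "(\<exists>j\<le>a. real (edge_distance E (\<gamma> i) (\<alpha> j)) \<le> \<delta> + 1) \<or>
    (\<exists>j\<le>b. real (edge_distance E (\<gamma> i) (\<beta> j)) \<le> \<delta> + 1)"
proof -
  let ?X = "graph_realization V E" and ?d = "realization_dist E"
  let ?A = "path_point \<alpha> a ` {0..real a}" and ?B = "path_point \<beta> b ` {0..real b}"
    and ?C = "path_point \<gamma> c ` {0..real c}"
  note segs = geodesic_segment_path[OF a(1) sym a(2)] geodesic_segment_path[OF b(1) sym b(2)]
    geodesic_segment_path[OF c(1) sym c(2)]
  have real: "path_point v L ` {0..real L} \<subseteq> ?X"
    if "geodesic_path E v L" "\<And>i. i \<le> L \<Longrightarrow> v i \<in> V" for v L
    using geodesic_segment_path[OF that(1) sym that(2)] unfolding geodesic_segment_def by blast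
  have corner: "vertex_point (v j) \<in> ?X"
    if "j \<le> L" "geodesic_path E v L" "\<And>i. i \<le> L \<Longrightarrow> v i \<in> V" for v j L
    using real[OF that(2,3)] path_point_real[OF geodesic_path_inj[OF that(2)] that(1)] that(1)
    by (metis atLeastAtMost_iff imageI of_nat_0_le_iff of_nat_le_iff subsetD)
  have "vertex_point (\<gamma> i) \<in> ?C"
    using path_point_real[OF geodesic_path_inj[OF c(1)] i] i by (intro image_eqI[of _ _ "real i"]) auto
  moreover have "\<forall>p\<in>?C. \<exists>q\<in>?A \<union> ?B. ?d p q \<le> \<delta>"
    using hyp(1) segs corner[OF _ a] corner[OF _ b] corner[OF _ c]
    unfolding delta_hyperbolic_def corners by (metis le0 order_refl)
  ultimately obtain q where q: "q \<in> ?A \<union> ?B" "?d (vertex_point (\<gamma> i)) q \<le> \<delta>" by blast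
  then have "q \<in> ?X" using real[OF a] real[OF b] by blast
  then obtain w where w: "w \<in> supp q" "real (edge_distance E (\<gamma> i) w) \<le> \<delta> + 1"
    using near_vertex[OF _ sym q(2) hyp(2)] by blast
  have "w \<in> \<alpha> ` {..a} \<or> w \<in> \<beta> ` {..b}"
    using q(1) w(1) supp_path_point[OF geodesic_path_inj[OF a(1)]]
      supp_path_point[OF geodesic_path_inj[OF b(1)]] by auto
  then show ?thesis using w(2) by auto
qed

section \<open>Commuting elements of a hyperbolic group\<close>

locale finitely_generated_group = group +
  fixes S
  assumes finite_generators: "finite S" and generators_carrier: "S \<subseteq> carrier G"
    and generate_generators: "generate G S = carrier G"
begin

abbreviation "E \<equiv> cayley_edges G S"

abbreviation "d \<equiv> edge_distance E"

lemma sym_cayley: "Relation.sym E"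
  by (auto simp: cayley_edges_def sym_def)

lemma cayley_translate:
  assumes "x \<in> carrier G" "(g, h) \<in> E"
  shows "(x \<otimes> g, x \<otimes> h) \<in> E"
proof -
  obtain s where s: "s \<in> S" "h = g \<otimes> s \<or> g = h \<otimes> s" "g \<in> carrier G" "h \<in> carrier G" "g \<noteq> h"
    using assms(2) by (auto simp: cayley_edges_def)
  have "s \<in> carrier G" using s(1) generators_carrier by auto
  then have "x \<otimes> h = x \<otimes> g \<otimes> s \<or> x \<otimes> g = x \<otimes> h \<otimes> s"
    using s assms(1) by (auto simp: m_assoc)
  moreover have "x \<otimes> g \<noteq> x \<otimes> h" using s assms(1) by simp
  ultimately show ?thesis using s assms(1) unfolding cayley_edges_def by auto
qed

lemma cayley_relpow_translate:
  assumes "x \<in> carrier G" "(g, h) \<in> E ^^ k"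
  shows "(x \<otimes> g, x \<otimes> h) \<in> E ^^ k"
  using assms(2)
proof (induction k arbitrary: h)
  case (Suc k)
  then show ?case using cayley_translate[OF assms(1)] by auto
qed simp

lemma d_translate:
  assumes "x \<in> carrier G" "g \<in> carrier G" "h \<in> carrier G"
  shows "d (x \<otimes> g) (x \<otimes> h) = d g h"
proof -
  have "(x \<otimes> g, x \<otimes> h) \<in> E ^^ k \<longleftrightarrow> (g, h) \<in> E ^^ k" for k
    using cayley_relpow_translate[of x g h k] assms
      cayley_relpow_translate[of "inv x" "x \<otimes> g" "x \<otimes> h" k]
    by (auto simp: m_assoc[symmetric])
  then show ?thesis by (simp add: edge_distance_def)
qed

lemma cayley_step: "g \<in> carrier G \<Longrightarrow> s \<in> S \<Longrightarrow> (g, g \<otimes> s) \<in> E\<^sup>* \<and> (g, g \<otimes> inv s) \<in> E\<^sup>*"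
proof -
  assume g: "g \<in> carrier G" and s: "s \<in> S"
  then have sc: "s \<in> carrier G" using generators_carrier by auto
  have "g \<otimes> s = g \<or> (g, g \<otimes> s) \<in> E" "g \<otimes> inv s = g \<or> (g, g \<otimes> inv s) \<in> E"
    using g s sc by (auto simp: cayley_edges_def m_assoc intro!: bexI[of _ s])
  then show ?thesis by auto
qed

lemma cayley_connected:
  assumes "g \<in> carrier G" "h \<in> carrier G"
  shows "(g, h) \<in> E\<^sup>*"
proof -
  have "\<forall>g\<in>carrier G. (g, g \<otimes> x) \<in> E\<^sup>*" if "x \<in> generate G S" for x
    using that
  proof (induction x rule: generate.induct)
    case (eng x y)
    then have "x \<in> carrier G" "y \<in> carrier G"
      using generate_generators by auto
    then show ?case
      using eng.IH by (metis m_assoc m_closed rtrancl_trans)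
  qed (use cayley_step in auto)
  moreover have "inv g \<otimes> h \<in> generate G S" using assms generate_generators by simp
  moreover have "g \<otimes> (inv g \<otimes> h) = h" using assms by (simp add: m_assoc[symmetric])
  ultimately show ?thesis using assms by metis
qed

lemma d_triangle:
  "x \<in> carrier G \<Longrightarrow> y \<in> carrier G \<Longrightarrow> z \<in> carrier G \<Longrightarrow> d x z \<le> d x y + d y z"
  by (intro edge_distance_triangle cayley_connected)

lemma d_commute: "d x y = d y x"
  by (rule edge_distance_commute[OF sym_cayley])

lemma finite_ball: "finite {u \<in> carrier G. d \<one> u \<le> K}"
proof -
  have step: "finite (E `` {g})" for g
  proof (rule finite_subset)
    show "E `` {g} \<subseteq> (\<lambda>s. g \<otimes> s) ` S \<union> (\<lambda>s. g \<otimes> inv s) ` S"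
    proof
      fix h assume "h \<in> E `` {g}"
      then obtain s where s: "s \<in> S" "g \<in> carrier G" "h \<in> carrier G" "h = g \<otimes> s \<or> g = h \<otimes> s"
        by (auto simp: cayley_edges_def)
      moreover have "s \<in> carrier G" using s generators_carrier by auto
      ultimately have "h = g \<otimes> s \<or> h = g \<otimes> inv s"
        by (auto simp: m_assoc)
      then show "h \<in> (\<lambda>s. g \<otimes> s) ` S \<union> (\<lambda>s. g \<otimes> inv s) ` S" using s(1) by auto
    qed
  qed (use finite_generators in auto)
  have sphere: "finite {u. (\<one>, u) \<in> E ^^ k}" for k
  proof (induction k)
    case (Suc k)
    have "{u. (\<one>, u) \<in> E ^^ Suc k} = (\<Union>g\<in>{u. (\<one>, u) \<in> E ^^ k}. E `` {g})" by auto
    then show ?case using Suc step by simp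
  qed simp
  have "{u \<in> carrier G. d \<one> u \<le> K} \<subseteq> (\<Union>k\<in>{..K}. {u. (\<one>, u) \<in> E ^^ k})"
    using edge_distance_relpow[OF cayley_connected[OF one_closed]] by auto
  then show ?thesis by (rule finite_subset) (use sphere in auto)
qed

lemma d_mult_le:
  assumes "x \<in> carrier G" "y \<in> carrier G"
  shows "d \<one> (x \<otimes> y) \<le> d \<one> x + d \<one> y"
  using d_triangle[of \<one> x "x \<otimes> y"] d_translate[of x \<one> y] assms by simp

lemma d_pow_le: "x \<in> carrier G \<Longrightarrow> d \<one> (x [^] (n::nat)) \<le> n * d \<one> x"
proof (induction n)
  case (Suc n)
  then show ?case using d_mult_le[of "x [^] n" x] by (simp add: nat_pow_Suc)
qed simp

lemma geodesic_from_one: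
  assumes "h \<in> carrier G"
  obtains v where "geodesic_path E v (d \<one> h)" "v 0 = \<one>" "v (d \<one> h) = h"
    "\<And>i. i \<le> d \<one> h \<Longrightarrow> v i \<in> carrier G"
proof -
  obtain v where v: "geodesic_path E v (d \<one> h)" "v 0 = \<one>" "v (d \<one> h) = h"
    using geodesic_path_exists[OF cayley_connected[OF one_closed assms]] by blast
  have "v i \<in> carrier G" if "i \<le> d \<one> h" for i
    using v that by (cases i) (auto simp: geodesic_path_def cayley_edges_def Suc_le_eq)
  with v show ?thesis by (rule that)
qed

lemma geodesic_path_translate:
  assumes "geodesic_path E v L" "\<And>i. i \<le> L \<Longrightarrow> v i \<in> carrier G" "x \<in> carrier G"
  shows "geodesic_path E (\<lambda>i. x \<otimes> v i) L"
  using assms by (auto simp: geodesic_path_def d_translate intro: cayley_translate)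

lemma geodesic_between:
  assumes "g \<in> carrier G" "h \<in> carrier G"
  obtains v where "geodesic_path E v (d g h)" "v 0 = g" "v (d g h) = h"
    "\<And>i. i \<le> d g h \<Longrightarrow> v i \<in> carrier G"
proof -
  have h: "inv g \<otimes> h \<in> carrier G" "g \<otimes> (inv g \<otimes> h) = h" "d \<one> (inv g \<otimes> h) = d g h"
    using assms d_translate[of g \<one> "inv g \<otimes> h"] by (auto simp: m_assoc[symmetric])
  obtain v where v: "geodesic_path E v (d g h)" "v 0 = \<one>" "v (d g h) = inv g \<otimes> h"
    "\<And>i. i \<le> d g h \<Longrightarrow> v i \<in> carrier G"
    using geodesic_from_one[OF h(1)] unfolding h(3) by blast
  show ?thesis
    by (rule that[of "\<lambda>i. g \<otimes> v i"]) (use v h assms geodesic_path_translate in auto)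
qed

text \<open>
  The points \<open>1\<close>, \<open>h\<close>, \<open>g h = h g\<close>, \<open>g\<close> are the corners of a geodesic quadrilateral. Because \<open>g\<close> and \<open>h\<close> commute,
  the two sides of length \<open>d 1 h\<close> are translates of each other by \<open>g\<close>, and the other two sides have
  length \<open>d 1 g\<close>. The point \<open>v M\<close> of a long side is too far from the short sides, so thinness of the two
  triangles cut by a diagonal puts it close to the opposite long side. By the triangle inequality, the
  position \<open>i\<close> that it meets there differs from \<open>M\<close> by at most \<open>R + 2 D < M\<close>.
\<close>

lemma translate_of_geodesic_is_close:
  assumes hyp: "delta_hyperbolic (graph_realization (carrier G) E) (realization_dist E) \<delta>" "0 \<le> \<delta>"
    and D: "\<delta> + 1 \<le> real D"
    and g: "g \<in> carrier G" and h: "h \<in> carrier G" and comm: "g \<otimes> h = h \<otimes> g"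
    and R: "d \<one> g \<le> R" and M: "M = R + 2 * D + 1" and long: "2 * M \<le> d \<one> h"
    and v: "geodesic_path E v (d \<one> h)" "v 0 = \<one>" "v (d \<one> h) = h"
      "\<And>i. i \<le> d \<one> h \<Longrightarrow> v i \<in> carrier G"
  obtains i where "i < 2 * M" "i \<le> d \<one> h" "d (g \<otimes> v i) (v M) \<le> 2 * D"
proof -
  let ?L = "d \<one> h" and ?gh = "g \<otimes> h"
  have gh: "?gh \<in> carrier G" using g h by simp
  have vM: "v M \<in> carrier G" using v(4) long by simp
  have dist: "d (v i) (v j) = j - i" if "i \<le> j" "j \<le> ?L" for i j
    using geodesic_path_distance[OF v(1) that] .
  obtain \<alpha> where \<alpha>: "geodesic_path E \<alpha> (d h ?gh)" "\<alpha> 0 = h" "\<alpha> (d h ?gh) = ?gh"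
    "\<And>i. i \<le> d h ?gh \<Longrightarrow> \<alpha> i \<in> carrier G"
    using geodesic_between[OF h gh] by blast
  obtain \<beta> where \<beta>: "geodesic_path E \<beta> (d ?gh \<one>)" "\<beta> 0 = ?gh" "\<beta> (d ?gh \<one>) = \<one>"
    "\<And>i. i \<le> d ?gh \<one> \<Longrightarrow> \<beta> i \<in> carrier G"
    using geodesic_between[OF gh one_closed] by blast
  obtain \<gamma> where \<gamma>: "geodesic_path E \<gamma> (d \<one> g)" "\<gamma> 0 = \<one>" "\<gamma> (d \<one> g) = g"
    "\<And>i. i \<le> d \<one> g \<Longrightarrow> \<gamma> i \<in> carrier G"
    using geodesic_from_one[OF g] by blast
  have gv: "geodesic_path E (\<lambda>i. g \<otimes> v i) ?L" "\<And>i. i \<le> ?L \<Longrightarrow> g \<otimes> v i \<in> carrier G"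
    using geodesic_path_translate[OF v(1,4) g] v(4) g by auto
  have hgh: "d h ?gh = d \<one> g" using comm d_translate[of h \<one> g] g h by simp
  have far_h: "D < d (v M) (\<alpha> j)" if "j \<le> d h ?gh" for j
  proof -
    have "d (v M) h \<le> d (v M) (\<alpha> j) + d (\<alpha> j) h"
      using d_triangle \<alpha>(4)[OF that] vM h by blast
    moreover have "d (\<alpha> j) h = j"
      using geodesic_path_distance[OF \<alpha>(1) _ that, of 0] \<alpha>(2) d_commute by simp
    moreover have "d (v M) h = ?L - M" using dist[of M ?L] v(3) long by simp
    ultimately show ?thesis using that hgh R M long by linarith
  qed
  have M_le: "M \<le> ?L" using long by simp
  \<comment> \<open>The triangle \<open>1\<close>, \<open>h\<close>, \<open>g h\<close> leads from the middle of the side \<open>v\<close> to the diagonal.\<close>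
  have "(\<exists>j\<le>d h ?gh. real (d (v M) (\<alpha> j)) \<le> \<delta> + 1) \<or>
      (\<exists>j\<le>d ?gh \<one>. real (d (v M) (\<beta> j)) \<le> \<delta> + 1)"
    by (rule thin_triangle_of_paths[OF hyp sym_cayley \<alpha>(1,4) \<beta>(1,4) v(1,4)])
      (use \<alpha> \<beta> v M_le in simp_all)
  moreover have "\<not> real (d (v M) (\<alpha> j)) \<le> \<delta> + 1" if "j \<le> d h ?gh" for j
    using far_h[OF that] D by linarith
  ultimately obtain j where j': "j \<le> d ?gh \<one>" "real (d (v M) (\<beta> j)) \<le> \<delta> + 1"
    by blast
  then have j: "j \<le> d ?gh \<one>" "d (v M) (\<beta> j) \<le> D" using D by linarith+
  have \<beta>j: "\<beta> j \<in> carrier G" using \<beta>(4) j(1) .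
  have far_g: "D < d (\<beta> j) (\<gamma> i)" if "i \<le> d \<one> g" for i
  proof -
    have "d \<one> (v M) \<le> d \<one> (\<gamma> i) + d (\<gamma> i) (v M)"
      "d (\<gamma> i) (v M) \<le> d (\<gamma> i) (\<beta> j) + d (\<beta> j) (v M)"
      using d_triangle \<gamma>(4)[OF that] vM \<beta>j one_closed by blast+
    moreover have "d \<one> (\<gamma> i) = i"
      using geodesic_path_distance[OF \<gamma>(1) _ that, of 0] \<gamma>(2) by simp
    moreover have "d \<one> (v M) = M" using dist[of 0 M] v(2) M_le by simp
    ultimately show ?thesis
      using that R M j(2) d_commute[of "\<gamma> i" "\<beta> j"] d_commute[of "v M" "\<beta> j"] by linarith
  qed
  \<comment> \<open>The triangle \<open>1\<close>, \<open>g\<close>, \<open>g h\<close> leads from the diagonal to the translated side.\<close>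
  have "(\<exists>i\<le>d \<one> g. real (d (\<beta> j) (\<gamma> i)) \<le> \<delta> + 1) \<or>
      (\<exists>i\<le>?L. real (d (\<beta> j) (g \<otimes> v i)) \<le> \<delta> + 1)"
    by (rule thin_triangle_of_paths[OF hyp sym_cayley \<gamma>(1,4) gv \<beta>(1,4)])
      (use \<gamma> \<beta> v j(1) g in simp_all)
  moreover have "\<not> real (d (\<beta> j) (\<gamma> i)) \<le> \<delta> + 1" if "i \<le> d \<one> g" for i
    using far_g[OF that] D by linarith
  ultimately obtain i where "i \<le> ?L" "real (d (\<beta> j) (g \<otimes> v i)) \<le> \<delta> + 1"
    by blast
  then have i: "i \<le> ?L" "d (\<beta> j) (g \<otimes> v i) \<le> D" using D by linarith+
  have gvi: "g \<otimes> v i \<in> carrier G" using gv(2) i(1) .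
  have close: "d (g \<otimes> v i) (v M) \<le> 2 * D"
    using d_triangle[OF gvi \<beta>j vM] i(2) j(2) d_commute[of "\<beta> j"] by fastforce
  have "d g (g \<otimes> v i) = i"
    using d_translate[of g \<one> "v i"] dist[of 0 i] v(2,4) i(1) g by simp
  moreover have "d g (g \<otimes> v i) \<le> d g \<one> + d \<one> (g \<otimes> v i)"
    "d \<one> (g \<otimes> v i) \<le> d \<one> (v M) + d (v M) (g \<otimes> v i)"
    using d_triangle g gvi vM one_closed by blast+
  moreover have "d \<one> (v M) = M" using dist[of 0 M] v(2) M_le by simp
  ultimately have "i < 2 * M"
    using close R M d_commute[of g \<one>] d_commute[of "v M"] by fastforce
  then show ?thesis using that i(1) close by blast
qed

text \<open>
  If \<open>u\<close> is the difference between \<open>g v\<^sub>i\<close> and \<open>v\<^sub>M\<close>, that is, \<open>v\<^sub>M = g v\<^sub>i u\<close>, then \<open>g\<close> is determined by \<open>i\<close> and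
  \<open>u\<close>. Since \<open>i\<close> takes at most \<open>2 M\<close> values and \<open>u\<close> lies in a fixed ball, the number of elements of
  length at most \<open>R\<close> that commute with a long element grows at most linearly in \<open>R\<close>.
\<close>

lemma card_commuting_le:
  assumes hyp: "delta_hyperbolic (graph_realization (carrier G) E) (realization_dist E) \<delta>" "0 \<le> \<delta>"
    and D: "\<delta> + 1 \<le> real D"
    and h: "h \<in> carrier G" and long: "2 * (R + 2 * D + 1) \<le> d \<one> h"
    and F: "\<And>g. g \<in> F \<Longrightarrow> g \<in> carrier G \<and> g \<otimes> h = h \<otimes> g \<and> d \<one> g \<le> R"
  shows "card F \<le> 2 * (R + 2 * D + 1) * card {u \<in> carrier G. d \<one> u \<le> 2 * D}"
proof -
  define M where "M = R + 2 * D + 1"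
  let ?B = "{u \<in> carrier G. d \<one> u \<le> 2 * D}"
  obtain v where v: "geodesic_path E v (d \<one> h)" "v 0 = \<one>" "v (d \<one> h) = h"
    "\<And>i. i \<le> d \<one> h \<Longrightarrow> v i \<in> carrier G"
    using geodesic_from_one[OF h] by blast
  have vM: "v M \<in> carrier G" using v(4) long M_def by simp
  have "F \<subseteq> (\<lambda>(i, u). v M \<otimes> inv (v i \<otimes> u)) ` ({..<2 * M} \<times> ?B)"
  proof
    fix g assume "g \<in> F"
    then have g: "g \<in> carrier G" "g \<otimes> h = h \<otimes> g" "d \<one> g \<le> R" using F by auto
    obtain i where i: "i < 2 * M" "i \<le> d \<one> h" "d (g \<otimes> v i) (v M) \<le> 2 * D"
      using translate_of_geodesic_is_close[OF hyp D g(1) h g(2,3) M_def _ v] long M_def by blast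
    have vi: "v i \<in> carrier G" using v(4) i(2) .
    let ?u = "inv (g \<otimes> v i) \<otimes> v M"
    have "d \<one> ?u = d (g \<otimes> v i) (v M)"
      using d_translate[of "g \<otimes> v i" \<one> ?u] g(1) vi vM by (simp add: m_assoc[symmetric])
    then have "?u \<in> ?B" using i(3) g(1) vi vM by simp
    moreover have "v i \<otimes> ?u = inv g \<otimes> v M"
      using g(1) vi vM by (simp add: inv_mult_group m_assoc[symmetric])
    then have "v M \<otimes> inv (v i \<otimes> ?u) = g"
      using g(1) vM by (simp add: inv_mult_group m_assoc[symmetric])
    ultimately show "g \<in> (\<lambda>(i, u). v M \<otimes> inv (v i \<otimes> u)) ` ({..<2 * M} \<times> ?B)"
      using i(1) by (intro image_eqI[of _ _ "(i, ?u)"]) auto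
  qed
  moreover have fin: "finite ({..<2 * M} \<times> ?B)" using finite_ball by simp
  ultimately have "card F \<le> card ({..<2 * M} \<times> ?B)"
    by (rule surj_card_le[rotated])
  then show ?thesis by (simp add: card_cartesian_product M_def)
qed

end

text \<open>
  The \<open>k\<^sup>2\<close> products \<open>a\<^sup>i b\<^sup>j\<close> with \<open>i, j < k\<close> have length at most linear in \<open>k\<close> and commute with every power
  of \<open>b\<close>, some of which are as long as desired. This contradicts the linear bound.
\<close>

lemma not_hyperbolic_if_free_abelian_rank_2:
  fixes G (structure)
  assumes "group G" and a: "a \<in> carrier G" and b: "b \<in> carrier G" and comm: "a \<otimes> b = b \<otimes> a"
    and inj: "\<And>(i :: nat) (j :: nat) (k :: nat) (l :: nat).
      a [^] i \<otimes> b [^] j = a [^] k \<otimes> b [^] l \<Longrightarrow> i = k \<and> j = l"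
  shows "\<not> hyperbolic_group G"
proof
  assume "hyperbolic_group G"
  then obtain S \<delta> where S: "finite S" "S \<subseteq> carrier G" "generate G S = carrier G" and "0 \<le> \<delta>"
    and hyp: "delta_hyperbolic (graph_realization (carrier G) (cayley_edges G S))
                 (realization_dist (cayley_edges G S)) \<delta>"
    unfolding hyperbolic_group_def by blast
  interpret group G by fact
  interpret finitely_generated_group G S by unfold_locales fact+
  define D where "D = nat \<lceil>\<delta> + 1\<rceil>"
  have D: "\<delta> + 1 \<le> real D" unfolding D_def by (rule real_nat_ceiling_ge)
  define N where "N = card {u \<in> carrier G. d \<one> u \<le> 2 * D}"
  define C where "C = d \<one> a + d \<one> b"
  \<comment> \<open>This \<open>k\<close> exceeds the slope \<open>2 (C + 2 D + 1) N\<close> of the linear bound, so \<open>k\<^sup>2\<close> violates the bound.\<close>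
  define k where "k = 2 * (C + 2 * D + 1) * N + 1"
  define R where "R = k * C"
  let ?F = "(\<lambda>(i, j). a [^] i \<otimes> b [^] j) ` ({..<k} \<times> {..<k})"
  obtain m :: nat where m: "2 * (R + 2 * D + 1) \<le> d \<one> (b [^] m)"
  proof (rule ccontr)
    assume *: "\<not> thesis"
    have "b [^] m \<in> {u \<in> carrier G. d \<one> u \<le> 2 * (R + 2 * D + 1)}" for m :: nat
      using * that[of m] b by force
    then have "finite (range (\<lambda>m::nat. b [^] m))"
      by (intro finite_subset[OF _ finite_ball]) blast
    moreover have "inj (\<lambda>m::nat. b [^] m)"
      using inj[of 0 _ 0 _] b by (intro injI) auto
    ultimately show False using finite_imageD infinite_UNIV_nat by blast
  qed
  have ab: "a [^] i \<otimes> b [^] j = b [^] j \<otimes> a [^] i" for i j :: nat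
    using a b comm by (metis group_commutes_pow nat_pow_closed)
  have F: "g \<in> carrier G \<and> g \<otimes> b [^] m = b [^] m \<otimes> g \<and> d \<one> g \<le> R" if "g \<in> ?F" for g
  proof -
    obtain i j where ij: "i < k" "j < k" "g = a [^] i \<otimes> b [^] j" using \<open>g \<in> ?F\<close> by auto
    have "d \<one> g \<le> i * d \<one> a + j * d \<one> b"
      unfolding ij(3)
      using d_mult_le[of "a [^] i" "b [^] j"] d_pow_le[OF a, of i] d_pow_le[OF b, of j] a b
      by (simp add: add_mono order_trans)
    also have "\<dots> \<le> k * d \<one> a + k * d \<one> b" using ij by (intro add_mono mult_right_mono) auto
    also have "\<dots> = R" by (simp add: R_def C_def algebra_simps)
    finally have "d \<one> g \<le> R" .
    moreover have "g \<otimes> b [^] m = b [^] m \<otimes> g"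
    proof -
      have "g \<otimes> b [^] m = a [^] i \<otimes> (b [^] m \<otimes> b [^] j)"
        using a b by (simp add: ij(3) m_assoc nat_pow_mult add.commute)
      also have "\<dots> = b [^] m \<otimes> g"
        using a b ab[of i m] by (simp add: ij(3) m_assoc[symmetric])
      finally show ?thesis .
    qed
    ultimately show ?thesis using a b ij(3) by simp
  qed
  have "inj_on (\<lambda>(i, j). a [^] i \<otimes> b [^] j) ({..<k} \<times> {..<k})"
  proof (rule inj_onI)
    fix p q :: "nat \<times> nat"
    assume "(case p of (i, j) \<Rightarrow> a [^] i \<otimes> b [^] j) = (case q of (i, j) \<Rightarrow> a [^] i \<otimes> b [^] j)"
    then show "p = q"
      using inj[of "fst p" "snd p" "fst q" "snd q"] by (simp add: case_prod_unfold prod_eq_iff)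
  qed
  then have "k * k = card ?F" by (simp add: card_image card_cartesian_product)
  also have "\<dots> \<le> 2 * (R + 2 * D + 1) * N"
    unfolding N_def using b by (intro card_commuting_le[OF hyp \<open>0 \<le> \<delta>\<close> D _ m F]) auto
  also have "\<dots> \<le> 2 * (k * (C + 2 * D + 1)) * N"
    by (intro mult_right_mono mult_left_mono) (auto simp: R_def k_def algebra_simps)
  also have "\<dots> < k * k"
    using k_def by (simp add: algebra_simps)
  finally show False by simp
qed

section \<open>The reflection representation of a Coxeter group\<close>

text \<open>
  This is the canonical bilinear form of the Coxeter group on the simple roots. A missing edge stands
  for the label \<open>\<infinity>\<close> and gives \<open>- cos 0\<close>.
\<close>

definition coxeter_form :: "labelled_graph \<Rightarrow> nat \<Rightarrow> nat \<Rightarrow> real" where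
  "coxeter_form \<Gamma> i j =
    (if i = j then 1 else case \<Gamma> {i, j} of None \<Rightarrow> -1 | Some m \<Rightarrow> - cos (pi / real m))"

text \<open>
  The reflections act on linear functionals \<open>y\<close>, given by their values \<open>y k\<close> on the simple roots, because
  this dual of the usual representation is free of sums over all vertices.
\<close>

definition reflect :: "labelled_graph \<Rightarrow> nat \<Rightarrow> (nat \<Rightarrow> real) \<Rightarrow> nat \<Rightarrow> real" where
  "reflect \<Gamma> i y = (\<lambda>k. y k - 2 * y i * coxeter_form \<Gamma> i k)"

text \<open>A generator and its formal inverse act alike, since reflections are involutions.\<close>

fun act :: "labelled_graph \<Rightarrow> nat word \<Rightarrow> (nat \<Rightarrow> real) \<Rightarrow> nat \<Rightarrow> real" where
  "act \<Gamma> [] = id"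
| "act \<Gamma> ((i, b) # w) = reflect \<Gamma> i \<circ> act \<Gamma> w"

lemma coxeter_form_self [simp]: "coxeter_form \<Gamma> i i = 1"
  by (simp add: coxeter_form_def)

lemma reflect_involution: "reflect \<Gamma> i (reflect \<Gamma> i y) = y"
  by (rule ext) (simp add: reflect_def algebra_simps)

lemma act_append: "act \<Gamma> (v @ w) = act \<Gamma> v \<circ> act \<Gamma> w"
  by (induction v) (auto simp: comp_assoc)

lemma act_concat_replicate: "act \<Gamma> (concat (replicate m w)) = act \<Gamma> w ^^ m"
  by (induction m) (simp_all add: act_append)

text \<open>
  Up to the factor \<open>sin \<theta>\<close>, the vector \<open>w \<phi> = sin (\<theta> + \<phi>) p + sin \<phi> q\<close> is the unit vector at angle
  \<open>\<phi>\<close> from \<open>p\<close> in the Euclidean plane spanned by \<open>p\<close> and \<open>q\<close>, which form the angle \<open>\<pi> - \<theta>\<close>. The two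
  reflections send it to \<open>w (\<pi> - \<phi>)\<close> and \<open>w (\<pi> - 2 \<theta> - \<phi>)\<close>, so their product rotates the plane by
  \<open>2 \<theta>\<close>. A vector whose coordinates \<open>i\<close> and \<open>j\<close> vanish is fixed, and these vectors complement the plane.
\<close>

lemma dihedral_order:
  fixes p q :: "nat \<Rightarrow> real" and i j m :: nat
  defines "\<theta> \<equiv> pi / real m"
  assumes m: "2 \<le> m" and p: "p i = 1" "p j = - cos \<theta>" and q: "q i = - cos \<theta>" "q j = 1"
  shows "((\<lambda>y k. y k - 2 * y i * p k) \<circ> (\<lambda>y k. y k - 2 * y j * q k)) ^^ m = id"
proof
  fix y :: "nat \<Rightarrow> real"
  define \<sigma> where "\<sigma> = (\<lambda>(y :: nat \<Rightarrow> real) k. y k - 2 * y i * p k)"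
  define \<tau> where "\<tau> = (\<lambda>(y :: nat \<Rightarrow> real) k. y k - 2 * y j * q k)"
  define w where "w = (\<lambda>\<phi> k. sin (\<theta> + \<phi>) * p k + sin \<phi> * q k)"
  have wi: "w \<phi> i = cos \<phi> * sin \<theta>" and wj: "w \<phi> j = - (cos (\<theta> + \<phi>) * sin \<theta>)" for \<phi>
  proof -
    show "w \<phi> i = cos \<phi> * sin \<theta>" by (simp add: w_def p q sin_add)
    have "sin \<phi> = sin (\<theta> + \<phi>) * cos \<theta> - cos (\<theta> + \<phi>) * sin \<theta>"
      using sin_diff[of "\<theta> + \<phi>" \<theta>] by simp
    then show "w \<phi> j = - (cos (\<theta> + \<phi>) * sin \<theta>)" by (simp add: w_def p q)
  qed
  have \<sigma>w: "w \<phi> k - 2 * w \<phi> i * p k = w (pi - \<phi>) k" for \<phi> k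
  proof -
    have "sin (\<theta> + \<phi>) - 2 * (cos \<phi> * sin \<theta>) = sin (\<phi> - \<theta>)"
      by (simp add: sin_add sin_diff algebra_simps)
    moreover have "sin (\<theta> + (pi - \<phi>)) = sin (\<phi> - \<theta>)"
      using sin_pi_minus[of "\<phi> - \<theta>"] by (simp add: algebra_simps)
    ultimately show ?thesis unfolding wi by (simp add: w_def algebra_simps)
  qed
  have \<tau>w: "w \<phi> k - 2 * w \<phi> j * q k = w (pi - 2 * \<theta> - \<phi>) k" for \<phi> k
  proof -
    have "sin (2 * \<theta> + \<phi>) = sin ((\<theta> + \<phi>) + \<theta>)" "sin \<phi> = sin ((\<theta> + \<phi>) - \<theta>)"
      by (simp_all add: algebra_simps)
    then have 1: "sin \<phi> + 2 * (cos (\<theta> + \<phi>) * sin \<theta>) = sin (2 * \<theta> + \<phi>)"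
      by (simp only: sin_add[of "\<theta> + \<phi>" \<theta>] sin_diff[of "\<theta> + \<phi>" \<theta>])
    have 2: "sin (pi - 2 * \<theta> - \<phi>) = sin (2 * \<theta> + \<phi>)"
      using sin_pi_minus[of "2 * \<theta> + \<phi>"] by (simp add: algebra_simps)
    have 3: "sin (\<theta> + (pi - 2 * \<theta> - \<phi>)) = sin (\<theta> + \<phi>)"
      using sin_pi_minus[of "\<theta> + \<phi>"] by (simp add: algebra_simps)
    have "w \<phi> k - 2 * w \<phi> j * q k =
        sin (\<theta> + \<phi>) * p k + (sin \<phi> + 2 * (cos (\<theta> + \<phi>) * sin \<theta>)) * q k"
      unfolding wj by (simp add: w_def algebra_simps)
    then show ?thesis by (simp only: 1) (simp only: w_def 2 3)
  qed
  have step: "(\<sigma> \<circ> \<tau>) (\<lambda>k. z k + a * w \<phi> k + b * w \<psi> k) =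
      (\<lambda>k. z k + a * w (\<phi> + 2 * \<theta>) k + b * w (\<psi> + 2 * \<theta>) k)"
    if z: "z i = 0" "z j = 0" for z :: "nat \<Rightarrow> real" and a b \<phi> \<psi>
  proof -
    have "\<tau> (\<lambda>k. z k + a * w \<phi> k + b * w \<psi> k) =
        (\<lambda>k. z k + a * w (pi - 2 * \<theta> - \<phi>) k + b * w (pi - 2 * \<theta> - \<psi>) k)"
    proof
      fix k
      have "\<tau> (\<lambda>k. z k + a * w \<phi> k + b * w \<psi> k) k =
          z k + a * (w \<phi> k - 2 * w \<phi> j * q k) + b * (w \<psi> k - 2 * w \<psi> j * q k)"
        by (simp add: \<tau>_def z algebra_simps)
      then show "\<tau> (\<lambda>k. z k + a * w \<phi> k + b * w \<psi> k) k =
          z k + a * w (pi - 2 * \<theta> - \<phi>) k + b * w (pi - 2 * \<theta> - \<psi>) k"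
        unfolding \<tau>w .
    qed
    moreover have "\<sigma> (\<lambda>k. z k + a * w \<phi> k + b * w \<psi> k) =
        (\<lambda>k. z k + a * w (pi - \<phi>) k + b * w (pi - \<psi>) k)" for \<phi> \<psi>
      by (rule ext) (simp add: \<sigma>_def \<sigma>w[symmetric] z algebra_simps)
    ultimately show ?thesis by (simp add: algebra_simps)
  qed
  have iter: "((\<sigma> \<circ> \<tau>) ^^ n) (\<lambda>k. z k + a * w \<phi> k + b * w \<psi> k) =
      (\<lambda>k. z k + a * w (\<phi> + 2 * real n * \<theta>) k + b * w (\<psi> + 2 * real n * \<theta>) k)"
    if z: "z i = 0" "z j = 0" for z :: "nat \<Rightarrow> real" and a b \<phi> \<psi> n
  proof (induction n)
    case (Suc n)
    then show ?case using step[OF z] by (simp add: algebra_simps)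
  qed simp
  define c where "c = cos \<theta>"
  define s where "s = sin \<theta>"
  have "0 < \<theta>" "\<theta> < pi" using m by (auto simp: \<theta>_def field_simps)
  then have s: "s \<noteq> 0" using sin_gt_zero[of \<theta>] by (simp add: s_def)
  have cs: "1 - c * c = s * s"
    using sin_cos_squared_add[of \<theta>] by (simp add: c_def s_def power2_eq_square)
  \<comment> \<open>\<open>\<alpha> p + \<beta> q\<close> is the vector of the plane with the same coordinates \<open>i\<close> and \<open>j\<close> as \<open>y\<close>.\<close>
  define \<alpha> where "\<alpha> = (y i + c * y j) / (s * s)"
  define \<beta> where "\<beta> = (y j + c * y i) / (s * s)"
  define z where "z = (\<lambda>k. y k - \<alpha> * p k - \<beta> * q k)"
  have "\<alpha> - c * \<beta> = y i * (1 - c * c) / (s * s)" "\<beta> - c * \<alpha> = y j * (1 - c * c) / (s * s)"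
    by (simp_all add: \<alpha>_def \<beta>_def diff_divide_distrib[symmetric] algebra_simps)
  then have z: "z i = 0" "z j = 0"
    using s by (simp_all add: z_def p q cs c_def[symmetric] algebra_simps)
  have y: "y = (\<lambda>k. z k + \<alpha> / s * w 0 k + (- \<beta> / s) * w (- \<theta>) k)"
    using s by (auto simp: z_def w_def s_def[symmetric])
  have "2 * real m * \<theta> = 2 * pi" using m by (simp add: \<theta>_def)
  then have "w (\<phi> + 2 * real m * \<theta>) = w (\<phi> + 2 * pi)" for \<phi>
    by (rule arg_cong)
  then have "w (\<phi> + 2 * real m * \<theta>) = w \<phi>" for \<phi>
    by (simp add: w_def add.assoc[symmetric])
  then have "((\<sigma> \<circ> \<tau>) ^^ m) y = y"
    using iter[OF z, of m "\<alpha> / s" 0 "- \<beta> / s" "- \<theta>"] y by metis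
  then show "(((\<lambda>y k. y k - 2 * y i * p k) \<circ> (\<lambda>y k. y k - 2 * y j * q k)) ^^ m) y = id y"
    by (simp add: \<sigma>_def \<tau>_def)
qed

text \<open>
  The label 1 is excluded, because it would require two distinct reflections to coincide. For the label
  0 the relation is trivial.
\<close>

lemma reflect_comp_order:
  assumes "i \<noteq> j" "\<Gamma> {i, j} = Some m" "m \<noteq> 1"
  shows "(reflect \<Gamma> i \<circ> reflect \<Gamma> j) ^^ m = id"
proof (cases "m = 0")
  case False
  then have "2 \<le> m" using assms(3) by simp
  moreover have "\<Gamma> {j, i} = Some m" using assms(2) by (simp add: insert_commute)
  ultimately show ?thesis
    using dihedral_order[of m "coxeter_form \<Gamma> i" i j "coxeter_form \<Gamma> j"] assms
    unfolding reflect_def by (simp add: coxeter_form_def)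
qed simp

text \<open>
  A presented group acts as soon as its relators act trivially. This detects different group
  elements without a solution of the word problem.
\<close>

lemma act_pres_eq:
  assumes "pres_eq S R v w" and R: "\<And>r. r \<in> R \<Longrightarrow> act \<Gamma> r = id"
  shows "act \<Gamma> v = act \<Gamma> w"
  using assms(1)
proof (induction rule: pres_eq.induct)
  case (cancel u v s b)
  then show ?case by (auto simp: act_append fun_eq_iff reflect_involution)
qed (simp_all add: act_append R)

section \<open>Translations in a triangle with labels 3\<close>

text \<open>Both sides are inverses of the involution \<open>y x y\<close>.\<close>

lemma (in group) braid_of_order_3:
  assumes x: "x \<in> carrier G" "x \<otimes> x = \<one>" and y: "y \<in> carrier G" "y \<otimes> y = \<one>"
    and xy: "x \<otimes> y \<otimes> x \<otimes> y \<otimes> x \<otimes> y = \<one>"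
  shows "x \<otimes> y \<otimes> x = y \<otimes> x \<otimes> y"
proof -
  have "(x \<otimes> y \<otimes> x) \<otimes> (y \<otimes> x \<otimes> y) = \<one>"
    using assms by (simp add: m_assoc)
  moreover have "(y \<otimes> x \<otimes> y) \<otimes> (y \<otimes> x \<otimes> y) = \<one>"
  proof -
    have "(y \<otimes> x \<otimes> y) \<otimes> (y \<otimes> x \<otimes> y) = y \<otimes> (x \<otimes> (y \<otimes> y) \<otimes> x) \<otimes> y"
      using x(1) y(1) by (simp add: m_assoc)
    also have "\<dots> = \<one>" using x y by (simp add: m_assoc)
    finally show ?thesis .
  qed
  ultimately show ?thesis
    using x(1) y(1) by (metis m_closed right_cancel)
qed

text \<open>Both products are equal to \<open>x y x z = y x y z\<close>.\<close>

lemma (in group) triangle_translations_commute: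
  assumes x: "x \<in> carrier G" "x \<otimes> x = \<one>" and y: "y \<in> carrier G" "y \<otimes> y = \<one>"
    and z: "z \<in> carrier G" "z \<otimes> z = \<one>"
    and xy: "x \<otimes> y \<otimes> x = y \<otimes> x \<otimes> y" and xz: "x \<otimes> z \<otimes> x = z \<otimes> x \<otimes> z"
    and yz: "y \<otimes> z \<otimes> y = z \<otimes> y \<otimes> z"
  shows "(x \<otimes> y \<otimes> z \<otimes> y) \<otimes> (y \<otimes> x \<otimes> z \<otimes> x) = (y \<otimes> x \<otimes> z \<otimes> x) \<otimes> (x \<otimes> y \<otimes> z \<otimes> y)"
proof -
  have reduce: "(u \<otimes> v \<otimes> w \<otimes> v) \<otimes> (v \<otimes> u \<otimes> w \<otimes> u) = u \<otimes> v \<otimes> u \<otimes> w"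
    if "u \<in> carrier G" "v \<in> carrier G" "v \<otimes> v = \<one>" "w \<in> carrier G" "w \<otimes> w = \<one>"
      "u \<otimes> w \<otimes> u = w \<otimes> u \<otimes> w" for u v w
  proof -
    have "(u \<otimes> v \<otimes> w \<otimes> v) \<otimes> (v \<otimes> u \<otimes> w \<otimes> u) = u \<otimes> v \<otimes> w \<otimes> (v \<otimes> v) \<otimes> (u \<otimes> w \<otimes> u)"
      using that(1,2,4) by (simp add: m_assoc)
    also have "\<dots> = u \<otimes> v \<otimes> (w \<otimes> w) \<otimes> u \<otimes> w"
      unfolding that(3,6) using that(1,2,4) by (simp add: m_assoc)
    finally show ?thesis using that by simp
  qed
  have "(x \<otimes> y \<otimes> z \<otimes> y) \<otimes> (y \<otimes> x \<otimes> z \<otimes> x) = (x \<otimes> y \<otimes> x) \<otimes> z"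
    using reduce[of x y z] x y z xz by simp
  also have "\<dots> = (y \<otimes> x \<otimes> z \<otimes> x) \<otimes> (x \<otimes> y \<otimes> z \<otimes> y)"
    unfolding xy using reduce[of y x z] x y z yz by simp
  finally show ?thesis .
qed

lemma presented_group_pow:
  assumes "w \<in> words S"
  shows "pres_class S R w [^]\<^bsub>presented_group S R\<^esub> n = pres_class S R (concat (replicate n w))"
proof (induction n)
  case 0
  then show ?case by (simp add: nat_pow_def presented_group_def)
next
  case (Suc n)
  have "concat (replicate n w) \<in> words S" using assms by (auto simp: words_def)
  moreover have "concat (replicate (Suc n) w) = concat (replicate n w) @ w"
    by (induction n) auto
  ultimately show ?case
    using Suc assms presented_group_mult[of "concat (replicate n w)" S w R]
    by (simp add: nat_pow_def)
qed

lemma pres_class_eqD: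
  "pres_class S R v = pres_class S R w \<Longrightarrow> w \<in> words S \<Longrightarrow> pres_eq S R v w"
  unfolding pres_class_def using pres_eq.refl by blast

text \<open>
  With \<open>c = y i + y j + y k\<close>, in the triangle, the words \<open>i j k j\<close> and \<open>j i k i\<close> add \<open>(-2 c, c, c)\<close> and
  \<open>(c, -2 c, c)\<close> to the coordinates \<open>(y i, y j, y k)\<close>; the second case is the first one with \<open>i\<close> and \<open>j\<close>
  exchanged. Both leave \<open>c\<close> unchanged, so on the plane \<open>c = 1\<close>
  they are two independent translations.
\<close>

lemma act_translation:
  assumes "distinct [i, j, k]" "\<Gamma> {i, j} = Some 3" "\<Gamma> {i, k} = Some 3" "\<Gamma> {j, k} = Some 3"
  defines "t \<equiv> [(i, True), (j, True), (k, True), (j, True)]"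
  shows "act \<Gamma> t y i = y i - 2 * (y i + y j + y k)"
    and "act \<Gamma> t y j = y j + (y i + y j + y k)"
    and "act \<Gamma> t y k = y k + (y i + y j + y k)"
proof -
  have form: "coxeter_form \<Gamma> i j = -1/2" "coxeter_form \<Gamma> j i = -1/2" "coxeter_form \<Gamma> i k = -1/2"
    "coxeter_form \<Gamma> k i = -1/2" "coxeter_form \<Gamma> j k = -1/2" "coxeter_form \<Gamma> k j = -1/2"
    using assms by (auto simp: coxeter_form_def cos_60 insert_commute)
  show "act \<Gamma> t y i = y i - 2 * (y i + y j + y k)" "act \<Gamma> t y j = y j + (y i + y j + y k)"
    "act \<Gamma> t y k = y k + (y i + y j + y k)"
    by (simp_all add: t_def reflect_def form algebra_simps)
qed

lemma act_translation_pow: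
  assumes "distinct [i, j, k]" "\<Gamma> {i, j} = Some 3" "\<Gamma> {i, k} = Some 3" "\<Gamma> {j, k} = Some 3"
  defines "t \<equiv> [(i, True), (j, True), (k, True), (j, True)]"
  shows "act \<Gamma> (concat (replicate n t)) y i = y i - 2 * real n * (y i + y j + y k)
    \<and> act \<Gamma> (concat (replicate n t)) y j = y j + real n * (y i + y j + y k)
    \<and> act \<Gamma> (concat (replicate n t)) y k = y k + real n * (y i + y j + y k)"
proof (induction n)
  case (Suc n)
  note tr = act_translation[OF assms(1-4), folded t_def]
  let ?y = "act \<Gamma> (concat (replicate n t)) y"
  have "act \<Gamma> (concat (replicate (Suc n) t)) y = act \<Gamma> t ?y" by (simp add: act_append)
  moreover have "?y i + ?y j + ?y k = y i + y j + y k" using Suc by (simp add: algebra_simps)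
  ultimately show ?case using Suc tr[of ?y] by (simp add: algebra_simps)
qed simp

lemma coxeter_group_triangle_not_hyperbolic:
  assumes ijk: "i < n" "j < n" "k < n" "distinct [i, j, k]"
    and 3: "\<Gamma> {i, j} = Some 3" "\<Gamma> {i, k} = Some 3" "\<Gamma> {j, k} = Some 3"
    and not1: "\<And>e. e \<in> vertex_pairs n \<Longrightarrow> \<Gamma> e \<noteq> Some 1"
  shows "\<not> hyperbolic_group (coxeter_group n \<Gamma>)"
proof -
  define R where "R = {[(i, True), (i, True)] |i. i < n} \<union>
     {concat (replicate m [(i, True), (j, True)]) |i j m.
        i < n \<and> j < n \<and> i \<noteq> j \<and> \<Gamma> {i, j} = Some m}"
  define G where "G = presented_group {..<n} R"
  have G: "coxeter_group n \<Gamma> = G" by (simp add: coxeter_group_def G_def R_def)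
  interpret G: group G unfolding G_def by (rule group_presented_group)
  let ?cl = "pres_class {..<n} R"
  have mult: "?cl v \<otimes>\<^bsub>G\<^esub> ?cl w = ?cl (v @ w)" if "v \<in> words {..<n}" "w \<in> words {..<n}" for v w
    unfolding G_def using that by (rule presented_group_mult)
  have carrier: "?cl w \<in> carrier G" if "w \<in> words {..<n}" for w
    using that by (simp add: G_def presented_group_def)
  have one: "\<one>\<^bsub>G\<^esub> = ?cl []" by (simp add: G_def presented_group_def)
  have rel: "?cl r = \<one>\<^bsub>G\<^esub>" if "r \<in> R" "r \<in> words {..<n}" for r
    unfolding one using pres_eq.relator[of "[]" "{..<n}" "[]" r R] that
    by (intro pres_class_eqI) (simp add: words_def)
  have act_R: "act \<Gamma> r = id" if r: "r \<in> R" for r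
  proof -
    consider i where "r = [(i, True), (i, True)]"
      | i j m where "r = concat (replicate m [(i, True), (j, True)])"
          "i < n" "j < n" "i \<noteq> j" "\<Gamma> {i, j} = Some m"
      using r unfolding R_def by blast
    then show ?thesis
    proof cases
      case 1
      then show ?thesis by (auto simp: reflect_involution)
    next
      case 2
      then have "{i, j} \<in> vertex_pairs n" by (auto simp: vertex_pairs_def)
      then have "m \<noteq> 1" using not1 2(5) by metis
      then show ?thesis
        using reflect_comp_order[of i j \<Gamma> m, OF 2(4,5)] 2(1) by (simp add: act_concat_replicate)
    qed
  qed
  let ?x = "\<lambda>i. ?cl [(i, True)]"
  have letter: "[(i, True)] \<in> words {..<n}" if "i < n" for i
    using that by (simp add: words_def)
  have sq: "?x i \<otimes>\<^bsub>G\<^esub> ?x i = \<one>\<^bsub>G\<^esub>" if "i < n" for i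
    using mult[OF letter[OF that] letter[OF that]] rel[of "[(i, True), (i, True)]"] that
    by (auto simp: R_def words_def)
  have braid: "?x i \<otimes>\<^bsub>G\<^esub> ?x j \<otimes>\<^bsub>G\<^esub> ?x i = ?x j \<otimes>\<^bsub>G\<^esub> ?x i \<otimes>\<^bsub>G\<^esub> ?x j"
    if "i < n" "j < n" "i \<noteq> j" "\<Gamma> {i, j} = Some 3" for i j
  proof (rule G.braid_of_order_3)
    let ?r = "concat (replicate 3 [(i, True), (j, True)])"
    have "?r \<in> R" using that unfolding R_def by blast
    moreover have "?r \<in> words {..<n}" using that by (simp add: words_def numeral_3_eq_3)
    ultimately have "?cl ?r = \<one>\<^bsub>G\<^esub>" by (rule rel)
    then show "?x i \<otimes>\<^bsub>G\<^esub> ?x j \<otimes>\<^bsub>G\<^esub> ?x i \<otimes>\<^bsub>G\<^esub> ?x j \<otimes>\<^bsub>G\<^esub> ?x i \<otimes>\<^bsub>G\<^esub> ?x j = \<one>\<^bsub>G\<^esub>"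
      using that by (simp add: mult words_def numeral_3_eq_3)
  qed (use that sq carrier letter in auto)
  define s where "s = [(i, True), (j, True), (k, True), (j, True)]"
  define t where "t = [(j, True), (i, True), (k, True), (i, True)]"
  have words: "s \<in> words {..<n}" "t \<in> words {..<n}"
    using ijk by (auto simp: s_def t_def words_def)
  have "?cl s = ?x i \<otimes>\<^bsub>G\<^esub> ?x j \<otimes>\<^bsub>G\<^esub> ?x k \<otimes>\<^bsub>G\<^esub> ?x j"
    "?cl t = ?x j \<otimes>\<^bsub>G\<^esub> ?x i \<otimes>\<^bsub>G\<^esub> ?x k \<otimes>\<^bsub>G\<^esub> ?x i"
    using ijk by (simp_all add: mult words_def s_def t_def)
  moreover have "(?x i \<otimes>\<^bsub>G\<^esub> ?x j \<otimes>\<^bsub>G\<^esub> ?x k \<otimes>\<^bsub>G\<^esub> ?x j) \<otimes>\<^bsub>G\<^esub>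
        (?x j \<otimes>\<^bsub>G\<^esub> ?x i \<otimes>\<^bsub>G\<^esub> ?x k \<otimes>\<^bsub>G\<^esub> ?x i) =
      (?x j \<otimes>\<^bsub>G\<^esub> ?x i \<otimes>\<^bsub>G\<^esub> ?x k \<otimes>\<^bsub>G\<^esub> ?x i) \<otimes>\<^bsub>G\<^esub>
        (?x i \<otimes>\<^bsub>G\<^esub> ?x j \<otimes>\<^bsub>G\<^esub> ?x k \<otimes>\<^bsub>G\<^esub> ?x j)"
    by (rule G.triangle_translations_commute)
      (use ijk 3 braid[of i j] braid[of i k] braid[of j k] in \<open>simp_all add: sq carrier letter\<close>)
  ultimately have comm: "?cl s \<otimes>\<^bsub>G\<^esub> ?cl t = ?cl t \<otimes>\<^bsub>G\<^esub> ?cl s" by simp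
  have "a = a' \<and> b = b'"
    if eq: "?cl s [^]\<^bsub>G\<^esub> a \<otimes>\<^bsub>G\<^esub> ?cl t [^]\<^bsub>G\<^esub> b = ?cl s [^]\<^bsub>G\<^esub> a' \<otimes>\<^bsub>G\<^esub> ?cl t [^]\<^bsub>G\<^esub> b'"
    for a b a' b' :: nat
  proof -
    let ?w = "\<lambda>a b. concat (replicate a s) @ concat (replicate b t)"
    have pow_words: "concat (replicate a s) \<in> words {..<n}" "concat (replicate a t) \<in> words {..<n}" for a
      using words by (auto simp: words_def)
    have prod: "?cl s [^]\<^bsub>G\<^esub> a \<otimes>\<^bsub>G\<^esub> ?cl t [^]\<^bsub>G\<^esub> b = ?cl (?w a b)" for a b :: nat
      using mult[OF pow_words] presented_group_pow[OF words(1)] presented_group_pow[OF words(2)]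
      by (simp add: G_def)
    have "?w a' b' \<in> words {..<n}" using pow_words by (auto simp: words_def)
    then have "act \<Gamma> (?w a b) = act \<Gamma> (?w a' b')"
      using eq unfolding prod by (intro act_pres_eq[OF pres_class_eqD act_R])
    \<comment> \<open>This point lies in the plane \<open>y i + y j + y k = 1\<close>.\<close>
    moreover define y where "y = (\<lambda>l. if l = i then 1 else 0 :: real)"
    have "act \<Gamma> (?w a b) y i = 1 - 2 * real a + real b \<and>
        act \<Gamma> (?w a b) y j = real a - 2 * real b" for a b
    proof -
      have d: "distinct [j, i, k]" "\<Gamma> {j, i} = Some 3" using ijk 3 by (auto simp: insert_commute)
      have y: "y i = 1" "y j = 0" "y k = 0" using ijk by (auto simp: y_def)
      let ?z = "act \<Gamma> (concat (replicate b t)) y"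
      have z: "?z j = - 2 * real b" "?z i = 1 + real b" "?z k = real b"
        using act_translation_pow[OF d 3(3,2), of b y] y by (simp_all add: t_def)
      show ?thesis
        using act_translation_pow[OF ijk(4) 3, of a ?z] z by (simp add: s_def act_append)
    qed
    ultimately have "1 - 2 * real a + real b = 1 - 2 * real a' + real b'"
      "real a - 2 * real b = real a' - 2 * real b'"
      by metis+
    then have "real a = real a'" "real b = real b'" by linarith+
    then show ?thesis by simp
  qed
  then show ?thesis
    unfolding G
    using not_hyperbolic_if_free_abelian_rank_2[OF G.is_group carrier[OF words(1)]
        carrier[OF words(2)] comm]
    by blast
qed

section \<open>Triangles with labels 3 in the random graph\<close>

text \<open>
  If \<open>X\<close> is the number of events that occur, then \<open>\<mu>\<^sup>2 \<le> (X - \<mu>)\<^sup>2\<close> wherever \<open>X = 0\<close>. The right-hand side below is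
  the variance of \<open>X\<close>.
\<close>

lemma prob_none_le_second_moment:
  fixes A :: "'b \<Rightarrow> 'a set" and M :: "'a pmf"
  assumes "finite T"
  defines "\<mu> \<equiv> \<Sum>t\<in>T. measure_pmf.prob M (A t)"
  shows "measure_pmf.prob M {x. \<forall>t\<in>T. x \<notin> A t} * \<mu>\<^sup>2 \<le>
    (\<Sum>s\<in>T. \<Sum>t\<in>T. measure_pmf.prob M (A s \<inter> A t)) - \<mu>\<^sup>2"
proof -
  define X where "X = (\<lambda>x. \<Sum>t\<in>T. indicator (A t) x :: real)"
  have int [simp]: "integrable (measure_pmf M) (indicator B :: 'a \<Rightarrow> real)" for B
    by (rule measure_pmf.integrable_const_bound[where B = 1]) auto
  have X2: "(X x)\<^sup>2 = (\<Sum>s\<in>T. \<Sum>t\<in>T. indicator (A s \<inter> A t) x)" for x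
    unfolding X_def power2_eq_square sum_product by (simp add: indicator_inter_arith)
  have intX: "integrable (measure_pmf M) X" "integrable (measure_pmf M) (\<lambda>x. (X x)\<^sup>2)"
    unfolding X2 unfolding X_def by simp_all
  have EX: "measure_pmf.expectation M X = \<mu>"
    unfolding X_def \<mu>_def by (subst Bochner_Integration.integral_sum) auto
  have EX2: "measure_pmf.expectation M (\<lambda>x. (X x)\<^sup>2) =
      (\<Sum>s\<in>T. \<Sum>t\<in>T. measure_pmf.prob M (A s \<inter> A t))"
    unfolding X2 by (simp add: Bochner_Integration.integral_sum)
  have "measure_pmf.prob M {x. \<forall>t\<in>T. x \<notin> A t} * \<mu>\<^sup>2 =
      measure_pmf.expectation M (\<lambda>x. indicator {x. \<forall>t\<in>T. x \<notin> A t} x * \<mu>\<^sup>2)"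
    by simp
  also have "\<dots> \<le> measure_pmf.expectation M (\<lambda>x. (X x)\<^sup>2 - 2 * \<mu> * X x + \<mu>\<^sup>2)"
  proof (rule integral_mono)
    show "indicator {x. \<forall>t\<in>T. x \<notin> A t} x * \<mu>\<^sup>2 \<le> (X x)\<^sup>2 - 2 * \<mu> * X x + \<mu>\<^sup>2" for x
    proof (cases "\<forall>t\<in>T. x \<notin> A t")
      case True
      then have "X x = 0" by (simp add: X_def)
      then show ?thesis by (simp add: indicator_def)
    next
      case False
      have "0 \<le> (X x - \<mu>)\<^sup>2" by simp
      then show ?thesis using False by (simp add: power2_diff algebra_simps)
    qed
  qed (use intX in simp_all)
  also have "\<dots> = measure_pmf.expectation M (\<lambda>x. (X x)\<^sup>2) - 2 * \<mu> * measure_pmf.expectation M X + \<mu>\<^sup>2"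
    using intX by simp
  also have "\<dots> = (\<Sum>s\<in>T. \<Sum>t\<in>T. measure_pmf.prob M (A s \<inter> A t)) - \<mu>\<^sup>2"
    unfolding EX EX2 by (simp add: power2_eq_square)
  finally show ?thesis .
qed

lemma finite_vertex_pairs: "finite (vertex_pairs n)"
  unfolding vertex_pairs_def by (rule finite_subset[of _ "Pow {..<n}"]) auto

lemma prob_all_labels_3:
  assumes "F \<subseteq> vertex_pairs n"
  shows "measure_pmf.prob (random_labelled_graph q n) {\<Gamma>. \<forall>e\<in>F. \<Gamma> e = Some 3} =
    pmf (label_pmf q) (Some 3) ^ card F"
proof -
  let ?B = "\<lambda>e. if e \<in> F then {Some 3} else UNIV"
  have Pi: "{\<Gamma>. \<forall>e\<in>F. \<Gamma> e = Some 3} = Pi (vertex_pairs n) ?B"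
    using assms by (auto simp: Pi_def)
  have "measure_pmf.prob (random_labelled_graph q n) {\<Gamma>. \<forall>e\<in>F. \<Gamma> e = Some 3} =
      (\<Prod>e\<in>vertex_pairs n. measure_pmf.prob (label_pmf q) (?B e))"
    unfolding random_labelled_graph_def Pi by (rule measure_Pi_pmf_Pi[OF finite_vertex_pairs])
  also have "\<dots> = (\<Prod>e\<in>vertex_pairs n. if e \<in> F then pmf (label_pmf q) (Some 3) else 1)"
    by (intro prod.cong) (auto simp: measure_pmf_single)
  also have "\<dots> = (\<Prod>e\<in>vertex_pairs n \<inter> F. pmf (label_pmf q) (Some 3))"
    by (rule prod.inter_restrict[symmetric, OF finite_vertex_pairs])
  also have "vertex_pairs n \<inter> F = F" using assms by blast
  finally show ?thesis by simp
qed

definition pairs :: "nat set \<Rightarrow> nat set set" where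
  "pairs t = {e. e \<subseteq> t \<and> card e = 2}"

definition triples :: "nat \<Rightarrow> nat set set" where
  "triples n = {t. t \<subseteq> {..<n} \<and> card t = 3}"

lemma card_pairs: "finite t \<Longrightarrow> card (pairs t) = card t choose 2"
  unfolding pairs_def by (rule n_subsets)

lemma finite_pairs: "finite t \<Longrightarrow> finite (pairs t)"
  unfolding pairs_def by (rule finite_subset[of _ "Pow t"]) auto

lemma card_triples: "card (triples n) = n choose 3"
  unfolding triples_def by (simp add: n_subsets)

lemma finite_triples: "finite (triples n)"
  unfolding triples_def by (rule finite_subset[of _ "Pow {..<n}"]) auto

lemma card_pairs_Un:
  assumes "card s = 3" "card t = 3"
  shows "card (pairs s \<union> pairs t) = 6 - (card (s \<inter> t) choose 2)"
proof -
  have fin: "finite s" "finite t" using assms by (auto intro: card_ge_0_finite)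
  have "pairs s \<inter> pairs t = pairs (s \<inter> t)" by (auto simp: pairs_def)
  moreover have "3 choose 2 = (3 :: nat)" by (simp add: numeral_3_eq_3 numeral_2_eq_2)
  ultimately show ?thesis
    using card_Un_Int[OF finite_pairs[OF fin(1)] finite_pairs[OF fin(2)]] fin assms
    by (simp add: card_pairs)
qed

text \<open>Such a triple arises from \<open>s\<close> by exchanging one of its three elements.\<close>

lemma card_sharing_edge_le:
  assumes s: "card s = 3"
  shows "card {t \<in> triples n. card (s \<inter> t) = 2} \<le> 3 * n"
proof -
  have fin: "finite s" using s by (auto intro: card_ge_0_finite)
  have "{t \<in> triples n. card (s \<inter> t) = 2} \<subseteq> (\<lambda>(x, y). insert y (s - {x})) ` (s \<times> {..<n})"
  proof
    fix t assume "t \<in> {t \<in> triples n. card (s \<inter> t) = 2}"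
    then have t: "t \<subseteq> {..<n}" "card t = 3" "card (s \<inter> t) = 2" by (auto simp: triples_def)
    then have fint: "finite t" by (auto intro: card_ge_0_finite)
    have "card (s - t) = 1" "card (t - s) = 1"
      using card_Diff_subset_Int[of s t] card_Diff_subset_Int[of t s] fin fint t s
      by (auto simp: Int_commute)
    then obtain x y where "s - t = {x}" "t - s = {y}" by (auto simp: card_1_singleton_iff)
    then show "t \<in> (\<lambda>(x, y). insert y (s - {x})) ` (s \<times> {..<n})"
      using t(1) by (intro image_eqI[of _ _ "(x, y)"]) auto
  qed
  then have "card {t \<in> triples n. card (s \<inter> t) = 2} \<le> card (s \<times> {..<n})"
    using fin by (intro surj_card_le) auto
  then show ?thesis using s by (simp add: card_cartesian_product)
qed

text \<open>
  Two triangles without a common edge are independent. So only the pairs of equal triangles and the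
  pairs with exactly one common edge contribute to the variance. Relative to the square of the mean,
  their shares are at most \<open>1 / (N q\<^sup>3)\<close> and \<open>3 n / (N q)\<close>, where \<open>N\<close> is the number of triples and
  \<open>N \<ge> (n / 3)\<^sup>3\<close>.
\<close>

lemma prob_no_triangle_le:
  assumes n: "3 \<le> n" and q: "pmf (label_pmf f) (Some 3) = q" "0 < q"
  shows "measure_pmf.prob (random_labelled_graph f n)
      {\<Gamma>. \<forall>t\<in>triples n. \<Gamma> \<notin> {\<Gamma>. \<forall>e\<in>pairs t. \<Gamma> e = Some 3}}
    \<le> 81 / (real n * q) + 27 / (real n * q) ^ 3"
proof -
  let ?P = "measure_pmf.prob (random_labelled_graph f n)"
  let ?A = "\<lambda>t. {\<Gamma>. \<forall>e\<in>pairs t. \<Gamma> e = Some 3}"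
  define N where "N = real (n choose 3)"
  have sub: "pairs t \<subseteq> vertex_pairs n" if "t \<in> triples n" for t
    using that by (auto simp: pairs_def triples_def vertex_pairs_def)
  have single: "?P (?A t) = q ^ 3" if "t \<in> triples n" for t
  proof -
    have "card t = 3" "finite t" using that by (auto simp: triples_def intro: card_ge_0_finite)
    then have "card (pairs t) = 3" by (simp add: card_pairs numeral_3_eq_3 numeral_2_eq_2)
    then show ?thesis using prob_all_labels_3[OF sub[OF that], of f] q by simp
  qed
  have double: "?P (?A s \<inter> ?A t) \<le>
      q ^ 6 + (if card (s \<inter> t) = 2 then q ^ 5 else 0) + (if s = t then q ^ 3 else 0)"
    if st: "s \<in> triples n" "t \<in> triples n" for s t
  proof -
    have c: "card s = 3" "card t = 3" "finite s" "finite t"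
      using st by (auto simp: triples_def intro: card_ge_0_finite)
    have Int: "?A s \<inter> ?A t = {\<Gamma>. \<forall>e\<in>pairs s \<union> pairs t. \<Gamma> e = Some 3}" by auto
    have P: "?P (?A s \<inter> ?A t) = q ^ (6 - (card (s \<inter> t) choose 2))"
      unfolding Int using prob_all_labels_3[of "pairs s \<union> pairs t" n f] sub[OF st(1)] sub[OF st(2)] q
        card_pairs_Un[OF c(1,2)] by simp
    have "card (s \<inter> t) \<le> 3" using card_mono[of s "s \<inter> t"] c by simp
    then consider "card (s \<inter> t) = 0" | "card (s \<inter> t) = 1" | "card (s \<inter> t) = 2" | "card (s \<inter> t) = 3"
      by linarith
    then show ?thesis
    proof cases
      case 4
      then have "s \<inter> t = s" "s \<inter> t = t"
        using card_subset_eq[of s "s \<inter> t"] card_subset_eq[of t "s \<inter> t"] c by auto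
      then have "s = t" by simp
      then show ?thesis unfolding P using 4 q by (simp add: numeral_3_eq_3 numeral_2_eq_2)
    qed (unfold P, use q in \<open>simp_all add: numeral_2_eq_2\<close>)
  qed
  have "(\<Sum>s\<in>triples n. \<Sum>t\<in>triples n. ?P (?A s \<inter> ?A t)) \<le>
      (\<Sum>s\<in>triples n. N * q ^ 6 + 3 * real n * q ^ 5 + q ^ 3)"
  proof (rule sum_mono)
    fix s assume s: "s \<in> triples n"
    then have c: "card s = 3" by (simp add: triples_def)
    have "(\<Sum>t\<in>triples n. ?P (?A s \<inter> ?A t)) \<le> (\<Sum>t\<in>triples n.
        q ^ 6 + (if card (s \<inter> t) = 2 then q ^ 5 else 0) + (if s = t then q ^ 3 else 0))"
      using double[OF s] by (rule sum_mono)
    also have "\<dots> = N * q ^ 6 + real (card {t \<in> triples n. card (s \<inter> t) = 2}) * q ^ 5 + q ^ 3"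
      using s finite_triples
      by (simp add: sum.distrib sum.If_cases card_triples N_def Int_def)
    also have "real (card {t \<in> triples n. card (s \<inter> t) = 2}) * q ^ 5 \<le> real (3 * n) * q ^ 5"
      using card_sharing_edge_le[OF c, of n] q by (intro mult_right_mono) auto
    finally show "(\<Sum>t\<in>triples n. ?P (?A s \<inter> ?A t)) \<le> N * q ^ 6 + 3 * real n * q ^ 5 + q ^ 3"
      by simp
  qed
  also have "\<dots> = N * (N * q ^ 6 + 3 * real n * q ^ 5 + q ^ 3)"
    by (simp add: card_triples N_def)
  finally have second: "(\<Sum>s\<in>triples n. \<Sum>t\<in>triples n. ?P (?A s \<inter> ?A t)) \<le>
      N * (N * q ^ 6 + 3 * real n * q ^ 5 + q ^ 3)" .
  have first: "(\<Sum>t\<in>triples n. ?P (?A t)) = N * q ^ 3"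
    using single by (simp add: card_triples N_def)
  have "?P {\<Gamma>. \<forall>t\<in>triples n. \<Gamma> \<notin> ?A t} * (N * q ^ 3)\<^sup>2 \<le>
      N * (N * q ^ 6 + 3 * real n * q ^ 5 + q ^ 3) - (N * q ^ 3)\<^sup>2"
    using prob_none_le_second_moment[OF finite_triples[of n], of "random_labelled_graph f n" ?A] second
    unfolding first by linarith
  also have "\<dots> = N * (3 * real n * q ^ 5 + q ^ 3)"
    by (simp add: algebra_simps power2_eq_square flip: power_add)
  finally have main: "?P {\<Gamma>. \<forall>t\<in>triples n. \<Gamma> \<notin> ?A t} * (N * q ^ 3)\<^sup>2 \<le> N * (3 * real n * q ^ 5 + q ^ 3)" .
  have N: "(real n / 3) ^ 3 \<le> N"
    unfolding N_def using binomial_ge_n_over_k_pow_k[of 3 n, where 'a = real] n by simp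
  have n0: "0 < real n" using n by simp
  then have N0: "0 < N" using N by (meson divide_pos_pos less_le_trans zero_less_numeral zero_less_power)
  have "?P {\<Gamma>. \<forall>t\<in>triples n. \<Gamma> \<notin> ?A t} \<le> N * (3 * real n * q ^ 5 + q ^ 3) / (N * q ^ 3)\<^sup>2"
    using main N0 q by (simp add: pos_le_divide_eq)
  also have "\<dots> = (3 * real n * q\<^sup>2 + 1) / (N * q ^ 3)"
    using N0 q by (simp add: field_simps power2_eq_square eval_nat_numeral)
  also have "\<dots> \<le> (3 * real n * q\<^sup>2 + 1) / ((real n / 3) ^ 3 * q ^ 3)"
    using N N0 q n0 by (intro divide_left_mono mult_right_mono mult_pos_pos) auto
  also have "\<dots> = 81 / (real n * (real n * q)) + 27 / (real n * q) ^ 3"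
    using n0 q by (simp add: field_simps power2_eq_square eval_nat_numeral)
  also have "81 / (real n * (real n * q)) \<le> 81 / (1 * (real n * q))"
    using n n0 q by (intro divide_left_mono mult_right_mono mult_pos_pos) auto
  finally show ?thesis by simp
qed

theorem theorem7:
  fixes p :: "nat \<Rightarrow> nat \<Rightarrow> real"
  assumes nonneg: "\<And>m n. 2 \<le> m \<Longrightarrow> 0 \<le> p m n"
    and summable: "\<And>n. (\<lambda>m. p m n) summable_on {2..}"
    and sum_le_1: "\<And>n. (\<Sum>\<^sub>\<infinity>m\<in>{2..}. p m n) \<le> 1"
    and p3: "filterlim (\<lambda>n. real n * p 3 n) at_top sequentially"
  shows "(\<lambda>n. measure_pmf.prob (random_labelled_graph (\<lambda>m. p m n) n)
            {\<Gamma>. \<not> hyperbolic_group (coxeter_group n \<Gamma>)}) \<longlonglongrightarrow> 1"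
proof (rule tendsto_sandwich)
  let ?M = "\<lambda>n. random_labelled_graph (\<lambda>m. p m n) n"
  let ?bound = "\<lambda>x::real. 1 - (81 / x + 27 / x ^ 3)"
  note label = pmf_label_pmf[OF nonneg summable sum_le_1]
  have no_label_1: "\<Gamma> e \<noteq> Some 1" if "\<Gamma> \<in> set_pmf (?M n)" "e \<in> vertex_pairs n" for \<Gamma> e n
  proof -
    have "\<Gamma> \<in> PiE_dflt (vertex_pairs n) None (set_pmf \<circ> (\<lambda>_. label_pmf (\<lambda>m. p m n)))"
      using that(1) unfolding random_labelled_graph_def
      by (rule set_Pi_pmf_subset'[OF finite_vertex_pairs, THEN subsetD])
    then have "\<Gamma> e \<in> set_pmf (label_pmf (\<lambda>m. p m n))"
      using that(2) by (auto simp: PiE_dflt_def)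
    then show ?thesis using label(2)[of n 1] by (auto simp: set_pmf_iff)
  qed
  have triangle: "\<not> hyperbolic_group (coxeter_group n \<Gamma>)"
    if \<Gamma>: "\<Gamma> \<in> set_pmf (?M n)" and t: "t \<in> triples n"
      and labels: "\<forall>e\<in>pairs t. \<Gamma> e = Some 3" for \<Gamma> t n
  proof -
    obtain i j k where ijk: "t = {i, j, k}" "i \<noteq> j" "j \<noteq> k" "i \<noteq> k"
      using t by (auto simp: triples_def card_3_iff)
    then have "{i, j} \<in> pairs t" "{i, k} \<in> pairs t" "{j, k} \<in> pairs t"
      by (auto simp: pairs_def)
    then show ?thesis
      using t labels ijk no_label_1[OF \<Gamma>]
      by (intro coxeter_group_triangle_not_hyperbolic[of i n j k]) (auto simp: triples_def)
  qed
  show "\<forall>\<^sub>F n in sequentially. ?bound (real n * p 3 n) \<le>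
      measure_pmf.prob (?M n) {\<Gamma>. \<not> hyperbolic_group (coxeter_group n \<Gamma>)}"
    using filterlim_at_top_dense[THEN iffD1, OF p3, rule_format, of 0] eventually_ge_at_top[of 3]
  proof eventually_elim
    case (elim n)
    let ?none = "{\<Gamma>. \<forall>t\<in>triples n. \<Gamma> \<notin> {\<Gamma>. \<forall>e\<in>pairs t. \<Gamma> e = Some 3}}"
    have "0 < p 3 n" using elim by (simp add: zero_less_mult_iff)
    then have "measure_pmf.prob (?M n) ?none \<le> 81 / (real n * p 3 n) + 27 / (real n * p 3 n) ^ 3"
      using prob_no_triangle_le[OF elim(2), of "\<lambda>m. p m n" "p 3 n"] label(2)[of n 3] by simp
    moreover have "1 - measure_pmf.prob (?M n) ?none = measure_pmf.prob (?M n) (- ?none)"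
      using measure_pmf.prob_compl[of ?none "?M n"] by (simp add: Compl_eq_Diff_UNIV)
    moreover have "measure_pmf.prob (?M n) (- ?none) \<le>
        measure_pmf.prob (?M n) {\<Gamma>. \<not> hyperbolic_group (coxeter_group n \<Gamma>)}"
      using triangle by (intro measure_pmf.finite_measure_mono_AE) (auto simp: AE_measure_pmf_iff)
    ultimately show ?case by linarith
  qed
  have "(?bound \<longlongrightarrow> 1) at_top"
    by real_asymp
  then show "(\<lambda>n. ?bound (real n * p 3 n)) \<longlonglongrightarrow> 1"
    using p3 by (rule filterlim_compose)
  show "\<forall>\<^sub>F n in sequentially.
      measure_pmf.prob (?M n) {\<Gamma>. \<not> hyperbolic_group (coxeter_group n \<Gamma>)} \<le> 1"
    by simp
qed simp

end
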